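(* Let $p(t) = (t-t_1)\cdots (t-t_n)$ be a polynomial such that $t_i\in\mathbb{R}$ for all $i$ and $t_i\neq t_j$ when $i\neq j$, let $H$ be an infinite-dimensional complex Hilbert space, and let $T\in B(H)$. Suppose that $p(T)$ is compact. Then there is a compact operator $K$ on $H$ such that $p(T+K)=0$ and $\|T+K\|=\|T\|_e$.
   Context: $B(H)$ is the algebra of bounded operators on $H$ and $K(H)$ the ideal of compact operators. $\|T\|_e$ denotes the essential norm of $T$, i.e. the norm of the image of $T$ in the Calkin algebra $B(H)/K(H)$. The operator $T$ is not assumed self-adjoint or normal. *)

theory Defs
  imports "HOL-Analysis.Analysis" "HOL-Computational_Algebra.Polynomial"
begin

class scaleC =
  fixes scaleC :: "complex \<Rightarrow> 'a \<Rightarrow> 'a"  (infixr \<open>*\<^sub>C\<close> 75)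

class complex_vector = real_vector + scaleC +
  assumes scaleC_add_right: "a *\<^sub>C (x + y) = a *\<^sub>C x + a *\<^sub>C y"
    and scaleC_add_left: "(a + b) *\<^sub>C x = a *\<^sub>C x + b *\<^sub>C x"
    and scaleC_scaleC: "a *\<^sub>C (b *\<^sub>C x) = (a * b) *\<^sub>C x"
    and scaleC_one: "1 *\<^sub>C x = x"
    and scaleR_scaleC: "r *\<^sub>R x = complex_of_real r *\<^sub>C x"

global_interpretation complex_vector: vector_space "scaleC :: complex \<Rightarrow> 'a \<Rightarrow> 'a::complex_vector"
  by unfold_locales (fact scaleC_add_right scaleC_add_left scaleC_scaleC scaleC_one)+

text \<open>
  A complex inner product space carries its underlying real inner product space
  structure: the real inner product is the real part of the complex one. Positive
  definiteness of \<open>cinner\<close> and the formula for the norm are therefore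
  inherited from \<^class>\<open>real_inner\<close> (see \<open>cinner_self\<close>).
\<close>

class complex_inner = complex_vector + real_inner +
  fixes cinner :: "'a \<Rightarrow> 'a \<Rightarrow> complex"
  assumes cinner_commute: "cinner y x = cnj (cinner x y)"
    and cinner_add_left: "cinner (x + y) z = cinner x z + cinner y z"
    and cinner_scaleC_left: "cinner (c *\<^sub>C x) y = c * cinner x y"
    and inner_eq_Re_cinner: "inner x y = Re (cinner x y)"

lemma cinner_self: "cinner x x = complex_of_real ((norm x)\<^sup>2)"
  for x :: "'a::complex_inner"
proof (rule complex_eqI)
  show "Re (cinner x x) = Re (complex_of_real ((norm x)\<^sup>2))"
    by (simp add: inner_eq_Re_cinner [symmetric] power2_norm_eq_inner)
  have "Im (cinner x x) = - Im (cinner x x)"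
    using arg_cong [OF cinner_commute [of x x], of Im] by simp
  then show "Im (cinner x x) = Im (complex_of_real ((norm x)\<^sup>2))"
    by simp
qed

class complex_hilbert_space = complex_inner + complete_space

text \<open>
  The type of bounded real-linear maps is cut down to the complex-linear ones. The
  norm of \<^typ>\<open>'a \<Rightarrow>\<^sub>L 'a\<close> is the usual operator norm,
  which does not depend on the scalar field.
\<close>

definition bounded_ops :: "('a::complex_hilbert_space \<Rightarrow>\<^sub>L 'a) set"
  where "bounded_ops = {T :: 'a \<Rightarrow>\<^sub>L 'a. \<forall>c x. T (c *\<^sub>C x) = c *\<^sub>C T x}"

definition compact_ops :: "('a::complex_hilbert_space \<Rightarrow>\<^sub>L 'a) set"
  where "compact_ops = {T \<in> bounded_ops. compact (closure (blinfun_apply T ` cball 0 1))}"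

text \<open>The quotient norm of the coset of \<open>T\<close> in the Calkin algebra.\<close>

definition essential_norm :: "('a::complex_hilbert_space \<Rightarrow>\<^sub>L 'a) \<Rightarrow> real"
  where "essential_norm T = Inf (norm ` {T + K | K. K \<in> compact_ops})"

definition op_power :: "('a::real_normed_vector \<Rightarrow>\<^sub>L 'a) \<Rightarrow> nat \<Rightarrow> ('a \<Rightarrow>\<^sub>L 'a)"
  where "op_power T k = ((\<lambda>S. T o\<^sub>L S) ^^ k) id_blinfun"

definition op_poly :: "real poly \<Rightarrow> ('a::real_normed_vector \<Rightarrow>\<^sub>L 'a) \<Rightarrow> ('a \<Rightarrow>\<^sub>L 'a)"
  where "op_poly p T = (\<Sum>k\<le>degree p. coeff p k *\<^sub>R op_power T k)"

end

theory Submission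
  imports Defs
begin

text \<open>
  Modulo compact operators \<open>T\<close> equals \<open>\<Sum> t\<^sub>i E\<^sub>i\<close> for the Lagrange idempotents
  \<open>E\<^sub>i = l\<^sub>i(T)\<close>. With \<open>G = \<Sum> E\<^sub>i\<^sup>* E\<^sub>i\<close> (bounded below) and \<open>V = G\<^sup>-\<^sup>1\<^sup>/\<^sup>2\<close> the operators
  \<open>V\<^sup>-\<^sup>1 E\<^sub>i V\<close> are essentially orthogonal projections, and these lift to genuine orthogonal
  projections \<open>P\<^sub>i\<close> with sum \<open>1\<close>. So \<open>T\<close> is a compact perturbation of
  \<open>V A V\<^sup>-\<^sup>1\<close> with \<open>A = \<Sum> t\<^sub>i P\<^sub>i\<close> self-adjoint, which already satisfies the polynomial equation.

  For the norm, \<open>\<parallel>S A S\<^sup>-\<^sup>1\<parallel> \<le> C\<close> holds iff \<open>C\<^sup>2 Q - A Q A \<ge> 0\<close> for \<open>Q = S\<^sup>2\<close>; since the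
  \<open>t\<^sub>i\<close> are real, this condition is linear in \<open>Q\<close> and acts on the block
  \<open>P\<^sub>i Q P\<^sub>j\<close> as multiplication by \<open>C\<^sup>2 - t\<^sub>i t\<^sub>j\<close>. For \<open>Q = V\<^sup>2\<close> and \<open>C\<close> the essential
  norm of \<open>T\<close> it holds modulo compact operators, so a compact change of the blocks of \<open>Q\<close>
  makes it hold exactly. A further compact block diagonal term keeps \<open>Q\<close> positive and
  invertible, and \<open>S = Q\<^sup>1\<^sup>/\<^sup>2\<close> is then a compact perturbation of \<open>V\<close>.
\<close>

section \<open>The algebra of bounded operators\<close>

instance complex_hilbert_space \<subseteq> banach ..

text \<open>The representing vector minimises \<open>J x = x \<bullet> x - 2 * f x\<close> over
  \<open>M\<close>; completeness provides the minimiser. With \<open>M = UNIV\<close> this yields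
  adjoints, with the functional \<open>z \<bullet> x\<close> on a closed subspace it yields
  orthogonal projections.\<close>

lemma riesz_closed_subspace:
  fixes f :: "'a::{real_inner, complete_space} \<Rightarrow> real"
  assumes f: "bounded_linear f" and M: "subspace M" "closed M"
  shows "\<exists>y\<in>M. \<forall>x\<in>M. f x = y \<bullet> x"
proof -
  interpret f: bounded_linear f by fact
  define J where "J x = x \<bullet> x - 2 * f x" for x
  obtain B where B: "norm (f x) \<le> norm x * B" for x
    using f.bounded by blast
  have J_ge: "- (B\<^sup>2) \<le> J x" for x
  proof -
    have "0 \<le> (norm x - B)\<^sup>2" by simp
    moreover have "f x \<le> norm x * B" using B[of x] by simp
    ultimately show ?thesis
      by (simp add: J_def power2_norm_eq_inner [symmetric] power2_diff algebra_simps)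
  qed
  define d where "d = Inf (J ` M)"
  have ne: "J ` M \<noteq> {}" using M(1) subspace_0 by blast
  have bdd: "bdd_below (J ` M)" using J_ge by (auto intro!: bdd_belowI[of _ "- (B\<^sup>2)"])
  have d_le: "d \<le> J x" if "x \<in> M" for x
    unfolding d_def using bdd that by (intro cInf_lower) auto
  have "\<exists>x\<in>M. J x < d + 1 / real (Suc n)" for n
    using cInf_lessD[OF ne, of "d + 1 / real (Suc n)"] by (auto simp: d_def)
  then obtain X where X: "\<And>n. X n \<in> M" "\<And>n. J (X n) < d + 1 / real (Suc n)" by metis
  \<comment> \<open>The parallelogram identity, with \<open>J\<close> bounded below by
    \<open>d\<close> at the midpoint of \<open>x\<close> and \<open>y\<close>; it makes the
    minimising sequence Cauchy.\<close>
  have key: "(norm (x - y))\<^sup>2 \<le> 2 * (J x - d) + 2 * (J y - d)" if "x \<in> M" "y \<in> M" for x y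
  proof -
    have "(1/2) *\<^sub>R (x + y) \<in> M" using that M(1) by (simp add: subspace_add subspace_scale)
    then have "d \<le> J ((1/2) *\<^sub>R (x + y))" by (rule d_le)
    then show ?thesis
      by (simp add: J_def power2_norm_eq_inner f.add f.scaleR inner_add inner_diff inner_commute
          algebra_simps)
  qed
  have "Cauchy X"
  proof (rule metric_CauchyI)
    fix e :: real assume e: "e > 0"
    obtain N where N: "1 / real (Suc N) < e\<^sup>2 / 4" using e nat_approx_posE[of "e\<^sup>2/4"] by auto
    have "dist (X m) (X n) < e" if "m \<ge> N" "n \<ge> N" for m n
    proof -
      have "1 / real (Suc k) \<le> 1 / real (Suc N)" if "k \<ge> N" for k
        using that by (simp add: frac_le)
      then have "J (X m) < d + e\<^sup>2/4" "J (X n) < d + e\<^sup>2/4"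
        using X(2)[of m] X(2)[of n] N that by (smt (verit))+
      then have "(norm (X m - X n))\<^sup>2 < e\<^sup>2" using key[OF X(1) X(1), of m n] by simp
      then show ?thesis using e by (simp add: dist_norm power2_less_imp_less)
    qed
    then show "\<exists>N. \<forall>m\<ge>N. \<forall>n\<ge>N. dist (X m) (X n) < e" by blast
  qed
  then obtain y where y: "X \<longlonglongrightarrow> y" using Cauchy_convergent convergent_def by blast
  have yM: "y \<in> M" using M(2) X(1) y closed_sequentially by blast
  have "(\<lambda>n. J (X n)) \<longlonglongrightarrow> J y"
    unfolding J_def by (intro tendsto_intros y f.tendsto)
  moreover have "(\<lambda>n. d + 1 / real (Suc n)) \<longlonglongrightarrow> d + 0"
    by (intro tendsto_intros LIMSEQ_Suc lim_1_over_n)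
  ultimately have Jy: "J y \<le> d"
    using X(2) LIMSEQ_le[of "\<lambda>n. J (X n)" "J y" "\<lambda>n. d + 1 / real (Suc n)" "d + 0"] by (force intro: less_imp_le)
  have "f x = y \<bullet> x" if x: "x \<in> M" for x
  proof -
    define a b where "a = x \<bullet> x" and "b = y \<bullet> x - f x"
    have a: "a \<ge> 0" by (simp add: a_def)
    have "0 \<le> s\<^sup>2 * a + 2 * s * b" for s
    proof -
      have "y + s *\<^sub>R x \<in> M" using yM x M(1) by (simp add: subspace_add subspace_scale)
      from d_le[OF this] Jy show ?thesis
        by (simp add: J_def a_def b_def f.add f.scaleR inner_add inner_commute power2_eq_square algebra_simps)
    qed
    note * = this
    \<comment> \<open>The quadratic in \<open>s\<close> is smallest at \<open>- b / a\<close>.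
      Dividing by \<open>a + 1\<close> instead admits \<open>a = 0\<close> and still gives a
      negative value unless \<open>b = 0\<close>.\<close>
    define k where "k = 1 / (a + 1)"
    have k: "k > 0" "k * a = 1 - k" using a by (simp_all add: k_def field_simps)
    have "(- b * k)\<^sup>2 * a + 2 * (- b * k) * b = b\<^sup>2 * k * (k * a) - 2 * b\<^sup>2 * k"
      by (simp add: power2_eq_square algebra_simps)
    also have "\<dots> = - (b\<^sup>2 * (k * (1 + k)))"
      unfolding k(2) by (simp add: algebra_simps)
    finally have "b\<^sup>2 * (k * (1 + k)) \<le> 0" using *[of "- b * k"] by simp
    then have "b = 0" using k(1) by (simp add: mult_le_0_iff)
    then show ?thesis by (simp add: b_def)
  qed
  with yM show ?thesis by blast
qed

section \<open>Bounded complex-linear operators as a complete normed algebra\<close>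

text \<open>
  The space may be trivial, so that \<open>norm 1 = 1\<close> and even \<open>0 \<noteq> 1\<close> can fail in the algebra
  of operators; this is why it is made an instance of \<^class>\<open>real_normed_algebra\<close> and
  \<^class>\<open>monoid_mult\<close> only.
\<close>

typedef (overloaded) 'a cop = "bounded_ops :: ('a::complex_hilbert_space \<Rightarrow>\<^sub>L 'a) set"
  by (rule exI[of _ 0]) (simp add: bounded_ops_def)

setup_lifting type_definition_cop

lemma scaleC_scaleR_commute: "c *\<^sub>C (r *\<^sub>R x) = r *\<^sub>R (c *\<^sub>C x)"
  for x :: "'a::complex_vector"
  by (simp add: scaleR_scaleC scaleC_scaleC mult.commute)

lemma scaleC_minus_right: "c *\<^sub>C (- x) = - (c *\<^sub>C x)" for x :: "'a::complex_vector"
  using scaleC_scaleR_commute[of c "-1" x] by simp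

lemma scaleC_diff_right: "c *\<^sub>C (x - y) = c *\<^sub>C x - c *\<^sub>C y" for x :: "'a::complex_vector"
  using scaleC_add_right[of c x "- y"] by (simp add: scaleC_minus_right)

instantiation cop :: (complex_hilbert_space) "{real_normed_algebra, monoid_mult}"
begin

lift_definition zero_cop :: "'a cop" is 0 by (simp add: bounded_ops_def)
lift_definition one_cop :: "'a cop" is id_blinfun by (simp add: bounded_ops_def)
lift_definition plus_cop :: "'a cop \<Rightarrow> 'a cop \<Rightarrow> 'a cop" is "(+)"
  by (simp add: bounded_ops_def blinfun.add_left scaleC_add_right)
lift_definition minus_cop :: "'a cop \<Rightarrow> 'a cop \<Rightarrow> 'a cop" is "(-)"
  by (simp add: bounded_ops_def blinfun.diff_left scaleC_diff_right)
lift_definition uminus_cop :: "'a cop \<Rightarrow> 'a cop" is uminus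
  by (simp add: bounded_ops_def blinfun.minus_left scaleC_minus_right)
lift_definition scaleR_cop :: "real \<Rightarrow> 'a cop \<Rightarrow> 'a cop" is scaleR
  by (simp add: bounded_ops_def blinfun.scaleR_left scaleC_scaleR_commute)
lift_definition times_cop :: "'a cop \<Rightarrow> 'a cop \<Rightarrow> 'a cop" is "(o\<^sub>L)"
  by (simp add: bounded_ops_def)
lift_definition norm_cop :: "'a cop \<Rightarrow> real" is norm .
definition "dist_cop (A :: 'a cop) B = norm (A - B)"
definition "sgn_cop (A :: 'a cop) = inverse (norm A) *\<^sub>R A"
definition "(uniformity :: ('a cop \<times> 'a cop) filter) = (INF e\<in>{0 <..}. principal {(x, y). dist x y < e})"
definition "open_cop (U :: 'a cop set) = (\<forall>x\<in>U. eventually (\<lambda>(x', y). x' = x \<longrightarrow> y \<in> U) uniformity)"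

instance
proof
  fix A B C :: "'a cop" and a b :: real
  show "dist A B = norm (A - B)" by (fact dist_cop_def)
  show "sgn A = inverse (norm A) *\<^sub>R A" by (fact sgn_cop_def)
  show "(uniformity :: ('a cop \<times> 'a cop) filter) = (INF e\<in>{0 <..}. principal {(x, y). dist x y < e})"
    by (fact uniformity_cop_def)
  show "open U = (\<forall>x\<in>U. \<forall>\<^sub>F (x', y) in uniformity. x' = x \<longrightarrow> y \<in> U)" for U :: "'a cop set"
    by (fact open_cop_def)
  show "A + B + C = A + (B + C)" "A + B = B + A" "0 + A = A" "- A + A = 0" "A - B = A + - B"
    by (transfer, simp)+
  show "a *\<^sub>R (A + B) = a *\<^sub>R A + a *\<^sub>R B" "(a + b) *\<^sub>R A = a *\<^sub>R A + b *\<^sub>R A"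
    "a *\<^sub>R b *\<^sub>R A = (a * b) *\<^sub>R A" "1 *\<^sub>R A = A"
    by (transfer, simp add: scaleR_add_right scaleR_add_left)+
  show "(norm A = 0) = (A = 0)" "norm (A + B) \<le> norm A + norm B" "norm (a *\<^sub>R A) = \<bar>a\<bar> * norm A"
    by (transfer, simp add: norm_triangle_ineq)+
  show "A * B * C = A * (B * C)" "1 * A = A" "A * 1 = A"
    "(A + B) * C = A * C + B * C" "A * (B + C) = A * B + A * C"
    "a *\<^sub>R A * B = a *\<^sub>R (A * B)" "A * a *\<^sub>R B = a *\<^sub>R (A * B)"
    by (transfer, auto intro!: blinfun_eqI simp: blinfun.bilinear_simps)+
  show "norm (A * B) \<le> norm A * norm B" by transfer (rule norm_blinfun_compose)
qed

end

instance cop :: (complex_hilbert_space) banach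
proof
  fix X :: "nat \<Rightarrow> 'a cop"
  assume X: "Cauchy X"
  define Y where "Y n = Rep_cop (X n)" for n
  have "Cauchy Y"
    using X unfolding Cauchy_def dist_norm Y_def by (simp add: norm_cop.rep_eq minus_cop.rep_eq)
  then obtain L where L: "Y \<longlonglongrightarrow> L" using Cauchy_convergent convergent_def by blast
  have "L \<in> bounded_ops"
    unfolding bounded_ops_def
  proof (intro CollectI allI)
    fix c x
    have lim: "(\<lambda>n. Y n z) \<longlonglongrightarrow> L z" for z
      by (intro tendsto_intros L)
    \<comment> \<open>Complex linearity survives the limit because multiplication by
      \<open>c\<close> is continuous; its bound comes from expanding
      \<open>cinner (c *\<^sub>C z) (c *\<^sub>C z)\<close>.\<close>
    have "bounded_linear (\<lambda>z. c *\<^sub>C z :: 'a)"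
    proof (rule bounded_linear_intro[where K = "cmod c"])
      fix z :: 'a
      have "cinner (c *\<^sub>C z) (c *\<^sub>C z) = c * cnj (cinner (c *\<^sub>C z) z)"
        by (metis cinner_commute cinner_scaleC_left)
      also have "\<dots> = complex_of_real ((cmod c * norm z)\<^sup>2)"
        by (simp add: cinner_scaleC_left cinner_self power_mult_distrib
            flip: complex_norm_square)
      finally have "(norm (c *\<^sub>C z))\<^sup>2 = (cmod c * norm z)\<^sup>2"
        unfolding cinner_self of_real_eq_iff .
      then show "norm (c *\<^sub>C z) \<le> norm z * cmod c" by (simp add: mult.commute)
    qed (simp_all add: scaleC_add_right scaleC_scaleR_commute)
    then have "(\<lambda>n. c *\<^sub>C Y n x) \<longlonglongrightarrow> c *\<^sub>C L x"
      using lim by (rule bounded_linear.tendsto)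
    moreover have "(\<lambda>n. c *\<^sub>C Y n x) = (\<lambda>n. Y n (c *\<^sub>C x))"
      using Rep_cop[of "X n" for n] by (simp add: Y_def bounded_ops_def)
    ultimately show "L (c *\<^sub>C x) = c *\<^sub>C L x" using lim LIMSEQ_unique by metis
  qed
  then have "Rep_cop (Abs_cop L) = L" by (rule Abs_cop_inverse)
  then have "X \<longlonglongrightarrow> Abs_cop L"
    using L by (simp add: lim_sequentially dist_norm Y_def norm_cop.rep_eq minus_cop.rep_eq)
  then show "convergent X" by (rule convergentI)
qed

lift_definition app :: "'a::complex_hilbert_space cop \<Rightarrow> 'a \<Rightarrow> 'a" (infixr \<open>\<cdot>\<close> 75) is blinfun_apply .

lemma cop_eqI: "(\<And>x. A \<cdot> x = B \<cdot> x) \<Longrightarrow> A = B"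
  by transfer (rule blinfun_eqI)

lemma bounded_bilinear_app: "bounded_bilinear app"
proof
  show "\<exists>K. \<forall>(A :: 'a cop) x. norm (A \<cdot> x) \<le> norm A * norm x * K"
    by (rule exI[of _ 1]) (transfer, simp add: norm_blinfun)
qed (transfer, simp add: blinfun.bilinear_simps)+

interpretation app: bounded_bilinear app by (rule bounded_bilinear_app)

lemma norm_app: "norm (A \<cdot> x) \<le> norm A * norm x"
  by transfer (rule norm_blinfun)

lemma norm_cop_bound: "0 \<le> b \<Longrightarrow> (\<And>x. norm (A \<cdot> x) \<le> b * norm x) \<Longrightarrow> norm A \<le> b"
  by transfer (rule norm_blinfun_bound)

lemma app_mult [simp]: "(A * B) \<cdot> x = A \<cdot> B \<cdot> x"
  by transfer simp

lemma app_one [simp]: "1 \<cdot> x = x"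
  by transfer simp

lemmas app_simps [simp] = app.add_left app.add_right app.diff_left app.diff_right
  app.minus_left app.minus_right app.scaleR_left app.scaleR_right app.zero_left app.zero_right
  app.sum_left app.sum_right

lemma app_scaleC [simp]: "A \<cdot> (c *\<^sub>C x) = c *\<^sub>C (A \<cdot> x)"
  by transfer (simp add: bounded_ops_def)

lemma cop_exists:
  fixes f :: "'a::complex_hilbert_space \<Rightarrow> 'a"
  assumes "bounded_linear f" "\<And>c x. f (c *\<^sub>C x) = c *\<^sub>C f x"
  shows "\<exists>B. \<forall>x. B \<cdot> x = f x"
proof -
  have "Blinfun f \<in> bounded_ops"
    by (simp add: bounded_ops_def bounded_linear_Blinfun_apply assms)
  then have "Abs_cop (Blinfun f) \<cdot> x = f x" for x
    by (simp add: app.rep_eq Abs_cop_inverse bounded_linear_Blinfun_apply assms(1))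
  then show ?thesis by blast
qed

lemma inner_scaleC_left: "(c *\<^sub>C x) \<bullet> y = x \<bullet> (cnj c *\<^sub>C y)"
  for x :: "'a::complex_inner"
proof -
  have "cinner x (cnj c *\<^sub>C y) = cnj (cnj c * cinner y x)"
    by (simp add: cinner_commute[of x "cnj c *\<^sub>C y"] cinner_scaleC_left)
  also have "\<dots> = cinner (c *\<^sub>C x) y"
    by (simp add: cinner_scaleC_left cinner_commute[of x y])
  finally show ?thesis by (simp add: inner_eq_Re_cinner)
qed

section \<open>Adjoints and orthogonal projections\<close>

text \<open>
  Adjoints are taken with respect to the real inner product; for complex-linear operators this
  is the usual adjoint.
\<close>

lemma adj_exists: "\<exists>B. \<forall>x y. (A \<cdot> x) \<bullet> y = x \<bullet> (B \<cdot> y)"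
proof -
  have "\<exists>z. \<forall>x. (A \<cdot> x) \<bullet> y = z \<bullet> x" for y
    using riesz_closed_subspace[of "\<lambda>x. (A \<cdot> x) \<bullet> y" UNIV]
    by (auto intro: bounded_linear_intros app.bounded_linear_right)
  then obtain g where g: "\<And>x y. (A \<cdot> x) \<bullet> y = g y \<bullet> x" by metis
  have eqI: "u = v" if "\<And>x. u \<bullet> x = v \<bullet> x" for u v :: 'a
    using that vector_eq_ldot by (metis inner_commute)
  have lin: "bounded_linear g"
  proof (rule bounded_linear_intro[where K = "norm A"])
    show "g (x + y) = g x + g y" for x y
      by (rule eqI) (simp add: inner_add flip: g)
    show "g (r *\<^sub>R x) = r *\<^sub>R g x" for r x
      by (rule eqI) (simp flip: g)
    show "norm (g x) \<le> norm x * norm A" for x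
    proof (cases "g x = 0")
      case False
      have "norm (g x) * norm (g x) = (A \<cdot> g x) \<bullet> x"
        by (simp add: g power2_norm_eq_inner flip: power2_eq_square)
      also have "\<dots> \<le> norm (A \<cdot> g x) * norm x" by (rule norm_cauchy_schwarz)
      also have "\<dots> \<le> norm (g x) * (norm x * norm A)"
        using mult_right_mono[OF norm_app[of A "g x"], of "norm x"] by (simp add: mult_ac)
      finally show ?thesis using False by simp
    qed simp
  qed
  moreover have "g (c *\<^sub>C x) = c *\<^sub>C g x" for c x
  proof (rule eqI)
    fix z
    have "g (c *\<^sub>C x) \<bullet> z = (A \<cdot> z) \<bullet> (c *\<^sub>C x)" by (simp add: g)
    also have "\<dots> = (A \<cdot> (cnj c *\<^sub>C z)) \<bullet> x"
      by (simp add: inner_scaleC_left)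
    also have "\<dots> = (c *\<^sub>C g x) \<bullet> z" by (simp only: g inner_scaleC_left)
    finally show "g (c *\<^sub>C x) \<bullet> z = (c *\<^sub>C g x) \<bullet> z" .
  qed
  ultimately obtain B where "\<And>x. B \<cdot> x = g x" using cop_exists by metis
  then have "(A \<cdot> x) \<bullet> y = x \<bullet> (B \<cdot> y)" for x y
    by (simp add: g inner_commute[of x])
  then show ?thesis by blast
qed

definition adj :: "'a::complex_hilbert_space cop \<Rightarrow> 'a cop" where
  "adj A = (SOME B. \<forall>x y. (A \<cdot> x) \<bullet> y = x \<bullet> (B \<cdot> y))"

lemma inner_adj_right: "x \<bullet> (adj A \<cdot> y) = (A \<cdot> x) \<bullet> y"
  using someI_ex[OF adj_exists[of A]] unfolding adj_def by metis

lemma inner_adj_left: "(adj A \<cdot> x) \<bullet> y = x \<bullet> (A \<cdot> y)"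
  using inner_adj_right[of y A x] by (simp only: inner_commute)


lemma adj_eqI:
  assumes "\<And>x y. (A \<cdot> x) \<bullet> y = x \<bullet> (B \<cdot> y)"
  shows "adj A = B"
proof (rule cop_eqI)
  fix y
  have "\<forall>x. x \<bullet> (adj A \<cdot> y) = x \<bullet> (B \<cdot> y)" by (simp add: inner_adj_right assms)
  then show "adj A \<cdot> y = B \<cdot> y" by (simp only: vector_eq_ldot)
qed

lemma adj_adj [simp]: "adj (adj A) = A"
  by (rule adj_eqI) (simp add: inner_adj_left)

lemma adj_add [simp]: "adj (A + B) = adj A + adj B"
  by (rule adj_eqI) (simp add: inner_add inner_adj_right)

lemma adj_diff [simp]: "adj (A - B) = adj A - adj B"
  by (rule adj_eqI) (simp add: inner_diff inner_adj_right)

lemma adj_scaleR [simp]: "adj (r *\<^sub>R A) = r *\<^sub>R adj A"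
  by (rule adj_eqI) (simp add: inner_adj_right)

lemma adj_mult [simp]: "adj (A * B) = adj B * adj A"
  by (rule adj_eqI) (simp add: inner_adj_right)

lemma adj_one [simp]: "adj 1 = 1"
  by (rule adj_eqI) simp

lemma adj_zero [simp]: "adj 0 = 0"
  by (rule adj_eqI) simp

lemma adj_sum [simp]: "adj (sum f I) = (\<Sum>i\<in>I. adj (f i))"
  by (induction I rule: infinite_finite_induct) auto

lemma bounded_linear_adj: "bounded_linear adj"
proof (rule bounded_linear_intro[where K = 1])
  fix A :: "'a cop"
  show "norm (adj A) \<le> norm A * 1"
  proof (rule norm_cop_bound)
    fix x
    have "norm (adj A \<cdot> x) * norm (adj A \<cdot> x) = (A \<cdot> adj A \<cdot> x) \<bullet> x"
      by (simp add: inner_adj_right [symmetric] power2_norm_eq_inner flip: power2_eq_square)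
    also have "\<dots> \<le> norm (A \<cdot> adj A \<cdot> x) * norm x" by (rule norm_cauchy_schwarz)
    also have "\<dots> \<le> norm (adj A \<cdot> x) * (norm A * norm x)"
      using mult_right_mono[OF norm_app[of A "adj A \<cdot> x"], of "norm x"] by (simp add: mult_ac)
    finally show "norm (adj A \<cdot> x) \<le> norm A * 1 * norm x"
      by (cases "adj A \<cdot> x = 0") auto
  qed simp
qed simp_all

lemma closed_selfadjoint: "closed {A. adj A = A}"
  by (intro closed_Collect_eq continuous_intros linear_continuous_on bounded_linear_adj)

text \<open>The value at \<open>z\<close> is the vector of \<open>M\<close> that represents
  \<open>z \<bullet> x\<close> on \<open>M\<close>. Assumption \<open>MC\<close> makes this map
  complex linear, hence an element of the operator algebra.\<close>

lemma orthogonal_projection_exists: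
  fixes M :: "'a::complex_hilbert_space set"
  assumes M: "subspace M" "closed M" and MC: "\<And>c x. x \<in> M \<Longrightarrow> c *\<^sub>C x \<in> M"
  shows "\<exists>N. adj N = N \<and> (\<forall>x. N \<cdot> x \<in> M) \<and> (\<forall>x\<in>M. N \<cdot> x = x)"
proof -
  have "\<exists>y\<in>M. \<forall>x\<in>M. z \<bullet> x = y \<bullet> x" for z
    by (rule riesz_closed_subspace[OF _ M]) (rule bounded_linear_inner_right)
  then obtain g where g: "\<And>z. g z \<in> M" "\<And>x z. x \<in> M \<Longrightarrow> g z \<bullet> x = z \<bullet> x" by metis
  have eqI: "u = v" if "u \<in> M" "v \<in> M" "\<And>x. x \<in> M \<Longrightarrow> u \<bullet> x = v \<bullet> x" for u v
  proof -
    have "(u - v) \<bullet> (u - v) = 0"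
      using that M(1) by (simp add: inner_diff subspace_diff)
    then show ?thesis by simp
  qed
  have lin: "bounded_linear g"
  proof (rule bounded_linear_intro[where K = 1])
    show "g (x + y) = g x + g y" for x y
      by (rule eqI) (use M(1) in \<open>simp_all add: g subspace_add inner_add\<close>)
    show "g (r *\<^sub>R x) = r *\<^sub>R g x" for r x
      by (rule eqI) (use M(1) in \<open>simp_all add: g subspace_scale\<close>)
    show "norm (g x) \<le> norm x * 1" for x
    proof (cases "g x = 0")
      case False
      have "norm (g x) * norm (g x) = x \<bullet> g x"
        by (simp add: g power2_norm_eq_inner flip: power2_eq_square)
      also have "\<dots> \<le> norm x * norm (g x)" by (rule norm_cauchy_schwarz)
      finally show ?thesis using False by simp
    qed simp
  qed
  moreover have "g (c *\<^sub>C x) = c *\<^sub>C g x" for c x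
    by (rule eqI) (simp_all add: g MC inner_scaleC_left)
  ultimately obtain N where N: "\<And>x. N \<cdot> x = g x" using cop_exists by metis
  have "adj N = N"
  proof (rule adj_eqI)
    fix x y
    have "g x \<bullet> y = g x \<bullet> g y" by (metis g inner_commute)
    then show "(N \<cdot> x) \<bullet> y = x \<bullet> (N \<cdot> y)" by (simp add: N g)
  qed
  moreover have "g x = x" if "x \<in> M" for x by (rule eqI) (simp_all add: g that)
  ultimately show ?thesis using N g(1) by auto
qed

section \<open>Compact operators\<close>

definition cpt :: "'a::complex_hilbert_space cop set" where
  "cpt = {A. Rep_cop A \<in> compact_ops}"

text \<open>Completeness of the space reduces compactness of the closure to total boundedness. The
  net points may lie anywhere, which suits the epsilon arguments below.\<close>

lemma cpt_iff_totally_bounded: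
  "A \<in> cpt \<longleftrightarrow> (\<forall>e>0. \<exists>F. finite F \<and> (\<forall>x. norm x \<le> 1 \<longrightarrow> (\<exists>y\<in>F. norm (A \<cdot> x - y) < e)))"
    (is "_ = ?rhs")
proof
  let ?S = "app A ` cball 0 1"
  have compact_iff: "A \<in> cpt \<longleftrightarrow> compact (closure ?S)"
    using Rep_cop[of A] by (simp add: cpt_def compact_ops_def app.rep_eq)
  show "A \<in> cpt" if rhs: ?rhs
    unfolding compact_iff compact_eq_totally_bounded
  proof safe
    show "complete (closure ?S)" by (simp add: complete_eq_closed)
  next
    fix e :: real assume e: "e > 0"
    obtain F where F: "finite F" "\<And>x. norm x \<le> 1 \<Longrightarrow> \<exists>y\<in>F. norm (A \<cdot> x - y) < e / 2"
      using rhs[rule_format, of "e/2"] e by auto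
    have "?S \<subseteq> (\<Union>y\<in>F. cball y (e / 2))"
      using F(2) by (force simp: dist_norm norm_minus_commute)
    then have "closure ?S \<subseteq> (\<Union>y\<in>F. cball y (e / 2))"
      by (rule closure_minimal) (use F(1) in auto)
    also have "\<dots> \<subseteq> (\<Union>y\<in>F. ball y e)" using e by auto
    finally show "\<exists>k. finite k \<and> closure ?S \<subseteq> (\<Union>x\<in>k. ball x e)" using F(1) by blast
  qed
  show ?rhs if "A \<in> cpt"
  proof (intro allI impI)
    fix e :: real assume "e > 0"
    with that obtain F where F: "finite F" "closure ?S \<subseteq> (\<Union>x\<in>F. ball x e)"
      unfolding compact_iff compact_eq_totally_bounded by blast
    have "\<exists>y\<in>F. norm (A \<cdot> x - y) < e" if "norm x \<le> 1" for x
    proof -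
      have "A \<cdot> x \<in> closure ?S" using that by (intro subsetD[OF closure_subset]) simp
      then have "A \<cdot> x \<in> (\<Union>y\<in>F. ball y e)" by (rule subsetD[OF F(2)])
      then show ?thesis by (simp add: dist_norm norm_minus_commute)
    qed
    with F(1) show "\<exists>F. finite F \<and> (\<forall>x. norm x \<le> 1 \<longrightarrow> (\<exists>y\<in>F. norm (A \<cdot> x - y) < e))"
      by blast
  qed
qed

lemma cptE:
  assumes "A \<in> cpt" "e > 0"
  obtains F where "finite F" "\<And>x. norm x \<le> 1 \<Longrightarrow> \<exists>y\<in>F. norm (A \<cdot> x - y) < e"
  using assms unfolding cpt_iff_totally_bounded by blast

lemma cpt_zero [simp]: "0 \<in> cpt"
  unfolding cpt_iff_totally_bounded by (auto intro!: exI[of _ "{0}"])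

lemma cpt_add:
  assumes "A \<in> cpt" "B \<in> cpt"
  shows "A + B \<in> cpt"
  unfolding cpt_iff_totally_bounded
proof (intro allI impI)
  fix e :: real assume e: "e > 0"
  obtain F where F: "finite F" "\<And>x. norm x \<le> 1 \<Longrightarrow> \<exists>y\<in>F. norm (A \<cdot> x - y) < e/2"
    using cptE[OF assms(1), of "e/2"] e by auto
  obtain G where G: "finite G" "\<And>x. norm x \<le> 1 \<Longrightarrow> \<exists>y\<in>G. norm (B \<cdot> x - y) < e/2"
    using cptE[OF assms(2), of "e/2"] e by auto
  have "\<exists>y\<in>(\<lambda>(u, v). u + v) ` (F \<times> G). norm ((A + B) \<cdot> x - y) < e" if x: "norm x \<le> 1" for x
  proof -
    obtain u v where uv: "u \<in> F" "norm (A \<cdot> x - u) < e/2" "v \<in> G" "norm (B \<cdot> x - v) < e/2"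
      using F(2)[OF x] G(2)[OF x] by blast
    have "norm ((A + B) \<cdot> x - (u + v)) \<le> norm (A \<cdot> x - u) + norm (B \<cdot> x - v)"
      using norm_triangle_ineq[of "A \<cdot> x - u" "B \<cdot> x - v"] by (simp add: algebra_simps)
    then show ?thesis using uv by force
  qed
  with F(1) G(1) show "\<exists>F. finite F \<and> (\<forall>x. norm x \<le> 1 \<longrightarrow> (\<exists>y\<in>F. norm ((A + B) \<cdot> x - y) < e))"
    by (intro exI[of _ "(\<lambda>(u, v). u + v) ` (F \<times> G)"]) auto
qed

lemma cpt_mult_left:
  assumes "K \<in> cpt"
  shows "A * K \<in> cpt"
  unfolding cpt_iff_totally_bounded
proof (intro allI impI)
  fix e :: real assume e: "e > 0"
  define d where "d = e / (norm A + 1)"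
  have pos: "0 < norm A + 1" using norm_ge_zero[of A] by linarith
  have d: "d > 0" "norm A * d < e"
    using e pos by (simp_all add: d_def pos_divide_less_eq algebra_simps)
  obtain F where F: "finite F" "\<And>x. norm x \<le> 1 \<Longrightarrow> \<exists>y\<in>F. norm (K \<cdot> x - y) < d"
    using cptE[OF assms d(1)] by auto
  have "\<exists>y\<in>app A ` F. norm ((A * K) \<cdot> x - y) < e" if x: "norm x \<le> 1" for x
  proof -
    obtain y where y: "y \<in> F" "norm (K \<cdot> x - y) < d" using F(2) x by blast
    have "norm (A \<cdot> (K \<cdot> x - y)) \<le> norm A * d"
      using norm_app[of A "K \<cdot> x - y"] y(2) mult_left_mono[of "norm (K \<cdot> x - y)" d "norm A"] by simp
    then show ?thesis using y(1) d(2) by (intro bexI[of _ "A \<cdot> y"]) auto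
  qed
  with F(1) show "\<exists>F. finite F \<and> (\<forall>x. norm x \<le> 1 \<longrightarrow> (\<exists>y\<in>F. norm ((A * K) \<cdot> x - y) < e))"
    by (intro exI[of _ "app A ` F"]) auto
qed

lemma cpt_scaleR: "K \<in> cpt \<Longrightarrow> r *\<^sub>R K \<in> cpt"
  using cpt_mult_left[of K "r *\<^sub>R 1"] by simp

lemma cpt_uminus: "K \<in> cpt \<Longrightarrow> - K \<in> cpt"
  using cpt_scaleR[of K "-1"] by simp

lemma cpt_diff: "A \<in> cpt \<Longrightarrow> B \<in> cpt \<Longrightarrow> A - B \<in> cpt"
  using cpt_add[of A "- B"] cpt_uminus[of B] by simp

lemma cpt_sum: "(\<And>i. i \<in> I \<Longrightarrow> f i \<in> cpt) \<Longrightarrow> sum f I \<in> cpt"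
  by (induction I rule: infinite_finite_induct) (auto simp: cpt_add)

text \<open>A finite net for the image under \<open>K\<close> is pulled back to points
  \<open>g y\<close> of the unit ball. The hypothesis at \<open>x - g y\<close> shows that their
  images under \<open>X\<close> form a net. It serves to derive compactness from estimates of
  quadratic forms.\<close>

lemma cpt_dominated:
  assumes K: "K \<in> cpt" and le: "\<And>x. (norm (X \<cdot> x))\<^sup>2 \<le> norm (K \<cdot> x) * norm x"
  shows "X \<in> cpt"
  unfolding cpt_iff_totally_bounded
proof (intro allI impI)
  fix e :: real assume e: "e > 0"
  obtain F where F: "finite F" "\<And>x. norm x \<le> 1 \<Longrightarrow> \<exists>y\<in>F. norm (K \<cdot> x - y) < e\<^sup>2/8"
    using cptE[OF K, of "e\<^sup>2/8"] e by auto
  \<comment> \<open>Only net points close to some \<open>K \<cdot> x\<close> have a preimage to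
    choose.\<close>
  define F' where "F' = {y \<in> F. \<exists>x. norm x \<le> 1 \<and> norm (K \<cdot> x - y) < e\<^sup>2/8}"
  have "\<forall>y\<in>F'. \<exists>x. norm x \<le> 1 \<and> norm (K \<cdot> x - y) < e\<^sup>2/8" by (auto simp: F'_def)
  then obtain g where g: "\<And>y. y \<in> F' \<Longrightarrow> norm (g y) \<le> 1"
      "\<And>y. y \<in> F' \<Longrightarrow> norm (K \<cdot> g y - y) < e\<^sup>2/8" by metis
  have "\<exists>z\<in>app X ` g ` F'. norm (X \<cdot> x - z) < e" if x: "norm x \<le> 1" for x
  proof -
    obtain y where y: "y \<in> F'" "norm (K \<cdot> x - y) < e\<^sup>2/8" using F(2)[OF x] x by (auto simp: F'_def)
    have "norm (K \<cdot> (x - g y)) \<le> norm (K \<cdot> x - y) + norm (K \<cdot> g y - y)"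
      using norm_triangle_ineq4[of "K \<cdot> x - y" "K \<cdot> g y - y"] by simp
    then have 1: "norm (K \<cdot> (x - g y)) \<le> e\<^sup>2/4" using y(2) g(2)[OF y(1)] by simp
    have 2: "norm (x - g y) \<le> 2" using norm_triangle_ineq4[of x "g y"] g(1)[OF y(1)] x by simp
    have "(norm (X \<cdot> (x - g y)))\<^sup>2 \<le> (e\<^sup>2/4) * 2"
      using le[of "x - g y"] mult_mono[OF 1 2] by simp
    also have "\<dots> < e\<^sup>2" using e by simp
    finally have "norm (X \<cdot> (x - g y)) < e" using e by (simp add: power2_less_imp_less)
    then show ?thesis using y(1) by auto
  qed
  then show "\<exists>F. finite F \<and> (\<forall>x. norm x \<le> 1 \<longrightarrow> (\<exists>y\<in>F. norm (X \<cdot> x - y) < e))"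
    using F(1) by (intro exI[of _ "app X ` g ` F'"]) (auto simp: F'_def)
qed

lemma cpt_adj_mult_self:
  assumes "adj X * X \<in> cpt"
  shows "X \<in> cpt"
proof (rule cpt_dominated[OF assms])
  fix x
  have "(norm (X \<cdot> x))\<^sup>2 = (adj X * X) \<cdot> x \<bullet> x"
    by (simp add: power2_norm_eq_inner inner_adj_left)
  then show "(norm (X \<cdot> x))\<^sup>2 \<le> norm ((adj X * X) \<cdot> x) * norm x"
    using norm_cauchy_schwarz[of "(adj X * X) \<cdot> x" x] by simp
qed

lemma cpt_mult_right:
  assumes "K \<in> cpt"
  shows "K * A \<in> cpt"
proof -
  have adj: "adj X \<in> cpt" if X: "X \<in> cpt" and XX: "X * adj X \<in> cpt" for X :: "'a cop"
    by (rule cpt_adj_mult_self) (use XX in simp)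
  show ?thesis
    unfolding cpt_iff_totally_bounded
  proof (intro allI impI)
    fix e :: real assume e: "e > 0"
    \<comment> \<open>The summand 1 keeps \<open>r\<close> positive for \<open>A = 0\<close>. Since
      \<open>(1 / r) *\<^sub>R A\<close> maps the unit ball into itself, a net for \<open>K\<close>
      scaled by \<open>r\<close> serves \<open>K * A\<close>.\<close>
    define r where "r = norm A + 1"
    have r: "r > 0" by (simp add: r_def add_nonneg_pos)
    obtain F where F: "finite F" "\<And>x. norm x \<le> 1 \<Longrightarrow> \<exists>y\<in>F. norm (K \<cdot> x - y) < e / r"
      using cptE[OF assms, of "e / r"] e r by auto
    have "\<exists>y\<in>scaleR r ` F. norm ((K * A) \<cdot> x - y) < e" if x: "norm x \<le> 1" for x
    proof -
      have "norm ((1 / r) *\<^sub>R A \<cdot> x) \<le> (1 / r) * (norm A * 1)"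
        using norm_app[of A x] x mult_left_mono[of "norm x" 1 "norm A"] r by (simp add: divide_right_mono)
      also have "\<dots> \<le> 1" using r by (simp add: r_def)
      finally obtain y where y: "y \<in> F" "norm (K \<cdot> ((1 / r) *\<^sub>R A \<cdot> x) - y) < e / r" using F(2) by blast
      have eq: "(K * A) \<cdot> x - r *\<^sub>R y = r *\<^sub>R (K \<cdot> ((1 / r) *\<^sub>R A \<cdot> x) - y)"
        using r by (simp add: scaleR_diff_right)
      have "norm ((K * A) \<cdot> x - r *\<^sub>R y) < e"
        unfolding eq norm_scaleR using mult_strict_left_mono[OF y(2) r] r by simp
      then show ?thesis using y(1) by blast
    qed
    with F(1) show "\<exists>F. finite F \<and> (\<forall>x. norm x \<le> 1 \<longrightarrow> (\<exists>y\<in>F. norm ((K * A) \<cdot> x - y) < e))"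
      by (intro exI[of _ "scaleR r ` F"]) auto
  qed
qed

text \<open>Schauder's theorem: for \<open>X = adj A\<close> the product \<open>adj X * X\<close> is
  \<open>A * adj A\<close>, which is compact by the ideal property.\<close>

lemma cpt_adj: "A \<in> cpt \<Longrightarrow> adj A \<in> cpt"
  by (rule cpt_adj_mult_self) (simp add: cpt_mult_right)

lemma cpt_approx:
  assumes "\<And>e. e > 0 \<Longrightarrow> \<exists>K\<in>cpt. norm (A - K) \<le> e"
  shows "A \<in> cpt"
  unfolding cpt_iff_totally_bounded
proof (intro allI impI)
  fix e :: real assume e: "e > 0"
  obtain K where K: "K \<in> cpt" "norm (A - K) \<le> e/2" using assms[of "e/2"] e by auto
  obtain F where F: "finite F" "\<And>x. norm x \<le> 1 \<Longrightarrow> \<exists>y\<in>F. norm (K \<cdot> x - y) < e/2"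
    using cptE[OF K(1), of "e/2"] e by auto
  have "\<exists>y\<in>F. norm (A \<cdot> x - y) < e" if x: "norm x \<le> 1" for x
  proof -
    obtain y where y: "y \<in> F" "norm (K \<cdot> x - y) < e/2" using F(2) x by blast
    have "norm ((A - K) \<cdot> x) \<le> e/2 * 1"
      using norm_app[of "A - K" x] mult_mono[OF K(2) x] e by simp
    then have "norm (A \<cdot> x - y) < e"
      using norm_triangle_ineq[of "(A - K) \<cdot> x" "K \<cdot> x - y"] y(2) by simp
    then show ?thesis using y(1) by blast
  qed
  with F(1) show "\<exists>F. finite F \<and> (\<forall>x. norm x \<le> 1 \<longrightarrow> (\<exists>y\<in>F. norm (A \<cdot> x - y) < e))" by blast
qed

section \<open>Noncompactness of the identity\<close>

text \<open>A Gram-Schmidt step: no finite set spans, so some vector lies outside the span of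
  \<open>Es\<close>, and removing its components along \<open>Es\<close> leaves a nonzero
  vector.\<close>

lemma exists_orthonormal:
  assumes inf: "\<not> (\<exists>B :: 'h::complex_hilbert_space set. finite B \<and> complex_vector.span B = UNIV)"
  shows "\<exists>Es :: 'h set. finite Es \<and> card Es = k \<and> (\<forall>x\<in>Es. norm x = 1) \<and> (\<forall>x\<in>Es. \<forall>y\<in>Es. x \<noteq> y \<longrightarrow> cinner x y = 0)"
proof (induction k)
  case 0
  show ?case by (rule exI[of _ "{}"]) simp
next
  case (Suc k)
  then obtain Es :: "'h set" where Es: "finite Es" "card Es = k" "\<forall>x\<in>Es. norm x = 1"
    "\<forall>x\<in>Es. \<forall>y\<in>Es. x \<noteq> y \<longrightarrow> cinner x y = 0" by (elim exE conjE) (rule that)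
  obtain x where x: "x \<notin> complex_vector.span Es" using inf Es(1) by blast
  define z where "z = x - (\<Sum>v\<in>Es. cinner x v *\<^sub>C v)"
  have "(\<Sum>v\<in>Es. cinner x v *\<^sub>C v) \<in> complex_vector.span Es"
    by (intro complex_vector.span_sum complex_vector.span_scale complex_vector.span_base)
  then have z0: "z \<noteq> 0" using x by (auto simp: z_def)
  have cinner_sum: "cinner (\<Sum>v\<in>S. f v) u = (\<Sum>v\<in>S. cinner (f v) u)" if "finite S"
    for S and f :: "'h \<Rightarrow> 'h" and u :: 'h
    using that
  proof (induction S rule: finite_induct)
    case empty
    show ?case using cinner_add_left[of "0::'h" 0 u] by simp
  qed (simp add: cinner_add_left)
  have z: "cinner z u = 0" if u: "u \<in> Es" for u
  proof -
    have "cinner (z + (\<Sum>v\<in>Es. cinner x v *\<^sub>C v)) u = cinner x u" by (simp add: z_def)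
    then have "cinner x u = cinner z u + (\<Sum>v\<in>Es. cinner x v * cinner v u)"
      by (simp add: cinner_add_left cinner_sum[OF Es(1)] cinner_scaleC_left)
    also have "(\<Sum>v\<in>Es. cinner x v * cinner v u) = (\<Sum>v\<in>Es. if v = u then cinner x u else 0)"
      using Es(3,4) u by (intro sum.cong) (auto simp: cinner_self)
    also have "\<dots> = cinner x u" using Es(1) u by simp
    finally show ?thesis by simp
  qed
  define w where "w = (1 / norm z) *\<^sub>R z"
  have w1: "norm w = 1" using z0 by (simp add: w_def)
  have w: "cinner w u = 0" if "u \<in> Es" for u
    using z[OF that] by (simp add: w_def scaleR_scaleC cinner_scaleC_left)
  have w': "cinner u w = 0" if "u \<in> Es" for u
    using w[OF that] cinner_commute[of u w] by simp
  have "w \<notin> Es" using w[of w] w1 by (auto simp: cinner_self)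
  then have "card (insert w Es) = Suc k" using Es(1,2) by simp
  moreover have "cinner u v = 0" if "u \<in> insert w Es" "v \<in> insert w Es" "u \<noteq> v" for u v
    using that Es(4) w w' by (elim insertE) simp_all
  ultimately show ?case
    using Es(1,3) w1 by (intro exI[of _ "insert w Es"]) simp
qed

text \<open>Orthonormal vectors are at distance \<open>sqrt 2\<close>, so no two of them lie within
  1/2 of the same net point; by pigeonhole the unit ball has no finite net. Infinite dimension
  enters the proof here.\<close>

lemma one_notin_cpt:
  assumes "\<not> (\<exists>B :: 'h::complex_hilbert_space set. finite B \<and> complex_vector.span B = UNIV)"
  shows "(1 :: 'h cop) \<notin> cpt"
proof
  assume "(1 :: 'h cop) \<in> cpt"
  then obtain F :: "'h set" where F: "finite F" "\<And>x. norm x \<le> 1 \<Longrightarrow> \<exists>y\<in>F. norm (x - y) < 1/2"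
    using cptE[of 1 "1/2"] by auto
  obtain Es :: "'h set" where Es: "finite Es" "card Es = card F + 1" "\<forall>x\<in>Es. norm x = 1"
    "\<forall>x\<in>Es. \<forall>y\<in>Es. x \<noteq> y \<longrightarrow> cinner x y = 0"
    using exists_orthonormal[OF assms, of "card F + 1"] by (elim exE conjE) (rule that)
  have "\<forall>x\<in>Es. \<exists>y. y \<in> F \<and> norm (x - y) < 1/2"
    using F(2) Es(3) by force
  then obtain g where g: "\<And>x. x \<in> Es \<Longrightarrow> g x \<in> F" "\<And>x. x \<in> Es \<Longrightarrow> norm (x - g x) < 1/2"
    unfolding bchoice_iff by blast
  have "card (g ` Es) < card Es"
    using card_mono[OF F(1), of "g ` Es"] g(1) Es(2) by force
  then have "\<not> inj_on g Es" by (rule pigeonhole)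
  then obtain x y where xy: "x \<in> Es" "y \<in> Es" "x \<noteq> y" "g x = g y" by (auto simp: inj_on_def)
  have "norm (x - y) < 1"
    using norm_triangle_ineq4[of "x - g x" "y - g y"] g(2)[OF xy(1)] g(2)[OF xy(2)] xy(4) by simp
  then have "(norm (x - y))\<^sup>2 < 1" by (simp add: power_less_one_iff)
  moreover have "x \<bullet> y = 0" using Es(4) xy(1-3) by (simp add: inner_eq_Re_cinner)
  moreover have "(norm (x - y))\<^sup>2 = (norm x)\<^sup>2 + (norm y)\<^sup>2 - 2 * (x \<bullet> y)"
    by (simp add: power2_norm_eq_inner inner_diff inner_commute)
  ultimately show False using Es(3) xy(1,2) by simp
qed

section \<open>Positive operators\<close>

text \<open>
  Self-adjointness has to be demanded explicitly: the quadratic form is taken in the real inner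
  product and vanishes for skew-adjoint operators.
\<close>

definition pos :: "'a::complex_hilbert_space cop \<Rightarrow> bool" where
  "pos A \<longleftrightarrow> adj A = A \<and> (\<forall>x. 0 \<le> (A \<cdot> x) \<bullet> x)"

lemma posI: "adj A = A \<Longrightarrow> (\<And>x. 0 \<le> (A \<cdot> x) \<bullet> x) \<Longrightarrow> pos A"
  by (simp add: pos_def)

lemma pos_adj: "pos A \<Longrightarrow> adj A = A"
  by (simp add: pos_def)

lemma pos_inner: "pos A \<Longrightarrow> 0 \<le> (A \<cdot> x) \<bullet> x"
  by (simp add: pos_def)

lemma selfadjoint_inner: "adj A = A \<Longrightarrow> (A \<cdot> x) \<bullet> y = x \<bullet> (A \<cdot> y)"
  using inner_adj_left[of A x y] by simp

lemma pos_zero: "pos 0" and pos_one: "pos 1"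
  by (simp_all add: pos_def)

lemma pos_add: "pos A \<Longrightarrow> pos B \<Longrightarrow> pos (A + B)"
  by (simp add: pos_def inner_add)

lemma pos_scaleR: "0 \<le> r \<Longrightarrow> pos A \<Longrightarrow> pos (r *\<^sub>R A)"
  by (simp add: pos_def)

lemma pos_sum: "(\<And>i. i \<in> I \<Longrightarrow> pos (f i)) \<Longrightarrow> pos (sum f I)"
  by (induction I rule: infinite_finite_induct) (auto simp: pos_zero pos_add)

lemma pos_conjugate: "pos A \<Longrightarrow> pos (adj X * A * X)"
  by (simp add: pos_def inner_adj_left mult.assoc)

lemma pos_conjugate_selfadjoint: "pos A \<Longrightarrow> adj X = X \<Longrightarrow> pos (X * A * X)"
  using pos_conjugate[of A X] by simp

lemma inner_adj_mult_self: "((adj X * X) \<cdot> x) \<bullet> x = (norm (X \<cdot> x))\<^sup>2"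
  by (simp add: inner_adj_left power2_norm_eq_inner)

lemma inner_square: "adj X = X \<Longrightarrow> ((X * X) \<cdot> x) \<bullet> x = (norm (X \<cdot> x))\<^sup>2"
  using inner_adj_mult_self[of X x] by simp

lemma pos_adj_mult_self: "pos (adj X * X)"
  by (rule posI) (simp_all add: inner_adj_left)

lemma pos_square: "adj X = X \<Longrightarrow> pos (X * X)"
  using pos_adj_mult_self[of X] by simp

lemma pos_Cauchy_Schwarz:
  assumes A: "pos A"
  shows "((A \<cdot> x) \<bullet> y)\<^sup>2 \<le> ((A \<cdot> x) \<bullet> x) * ((A \<cdot> y) \<bullet> y)"
proof -
  define p q b where "p = (A \<cdot> x) \<bullet> x" and "q = (A \<cdot> y) \<bullet> y" and "b = (A \<cdot> x) \<bullet> y"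
  have b: "(A \<cdot> y) \<bullet> x = b"
    using selfadjoint_inner[OF pos_adj[OF A], of x y] unfolding b_def by (simp only: inner_commute)
  have expand: "(A \<cdot> (r *\<^sub>R x - s *\<^sub>R y)) \<bullet> (r *\<^sub>R x - s *\<^sub>R y) = r * r * p - 2 * r * s * b + s * s * q" for r s
    by (simp add: inner_diff b p_def [symmetric] q_def [symmetric] b_def [symmetric] right_diff_distrib mult_ac)
  have ge: "0 \<le> r * r * p - 2 * r * s * b + s * s * q" for r s
    using pos_inner[OF A, of "r *\<^sub>R x - s *\<^sub>R y"] unfolding expand .
  have pq: "p \<ge> 0" "q \<ge> 0" using pos_inner[OF A] by (simp_all add: p_def q_def)
  \<comment> \<open>The form may be degenerate, so no single choice of \<open>r\<close> and
    \<open>s\<close> suffices: \<open>(q, b)\<close> works if \<open>q > 0\<close>,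
    \<open>(b, p)\<close> if \<open>p > 0\<close>, and \<open>(1, b)\<close> if both vanish.\<close>
  have 1: "b\<^sup>2 \<le> p * q" if "q > 0"
  proof -
    have "0 \<le> q * (p * q - b\<^sup>2)" using ge[of q b] by (simp add: algebra_simps power2_eq_square)
    then show ?thesis using that by (simp add: zero_le_mult_iff)
  qed
  have 2: "b\<^sup>2 \<le> p * q" if "p > 0"
  proof -
    have "0 \<le> p * (p * q - b\<^sup>2)" using ge[of b p] by (simp add: algebra_simps power2_eq_square)
    then show ?thesis using that by (simp add: zero_le_mult_iff)
  qed
  have 3: "b\<^sup>2 \<le> p * q" if "p = 0" "q = 0"
    using ge[of 1 b] that by (simp add: power2_eq_square)
  have "b\<^sup>2 \<le> p * q" using 1 2 3 pq by linarith
  then show ?thesis unfolding p_def q_def b_def .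
qed

lemma inner_app_le_norm: "(A \<cdot> x) \<bullet> x \<le> norm A * (norm x)\<^sup>2"
proof -
  have "(A \<cdot> x) \<bullet> x \<le> norm (A \<cdot> x) * norm x" by (rule norm_cauchy_schwarz)
  also have "\<dots> \<le> norm A * norm x * norm x" by (rule mult_right_mono[OF norm_app]) simp
  finally show ?thesis by (simp add: power2_eq_square)
qed

text \<open>Cauchy-Schwarz for the form of \<open>A\<close> at \<open>x\<close> and
  \<open>A \<cdot> x\<close>, with one factor \<open>(norm (A \<cdot> x))\<^sup>2\<close>
  cancelled.\<close>

lemma pos_norm_app:
  assumes A: "pos A" and m: "\<And>x. (A \<cdot> x) \<bullet> x \<le> m * (norm x)\<^sup>2"
  shows "(norm (A \<cdot> x))\<^sup>2 \<le> m * ((A \<cdot> x) \<bullet> x)"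
proof (cases "A \<cdot> x = 0")
  case False
  let ?n = "(norm (A \<cdot> x))\<^sup>2" and ?q = "(A \<cdot> x) \<bullet> x"
  have "?n * ?n = ((A \<cdot> x) \<bullet> (A \<cdot> x))\<^sup>2"
    unfolding power2_norm_eq_inner by (simp only: power2_eq_square)
  also have "\<dots> \<le> ?q * ((A \<cdot> A \<cdot> x) \<bullet> (A \<cdot> x))" by (rule pos_Cauchy_Schwarz[OF A])
  also have "\<dots> \<le> ?q * (m * ?n)" by (rule mult_left_mono[OF m pos_inner[OF A]])
  finally have "?n * ?n \<le> (m * ?q) * ?n" by (simp add: mult_ac)
  then show ?thesis by (rule mult_right_le_imp_le) (use False in simp)
qed simp

lemma pos_norm_le:
  assumes A: "pos A" and m: "\<And>x. (A \<cdot> x) \<bullet> x \<le> m * (norm x)\<^sup>2" "0 \<le> m"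
  shows "norm A \<le> m"
proof (rule norm_cop_bound[OF m(2)])
  fix x
  have "(norm (A \<cdot> x))\<^sup>2 \<le> m * ((A \<cdot> x) \<bullet> x)" by (rule pos_norm_app[OF A m(1)])
  also have "\<dots> \<le> m * (norm (A \<cdot> x) * norm x)" by (rule mult_left_mono[OF norm_cauchy_schwarz m(2)])
  finally have *: "norm (A \<cdot> x) * norm (A \<cdot> x) \<le> (m * norm x) * norm (A \<cdot> x)"
    by (simp only: power2_eq_square mult_ac)
  show "norm (A \<cdot> x) \<le> m * norm x"
  proof (cases "A \<cdot> x = 0")
    case False
    then show ?thesis by (intro mult_right_le_imp_le[OF *]) simp
  qed (simp add: m(2))
qed

lemma pos_app_eq_zero:
  assumes "pos A" "(A \<cdot> x) \<bullet> x = 0"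
  shows "A \<cdot> x = 0"
  using pos_norm_app[OF assms(1) inner_app_le_norm, of x] assms(2) by simp

text \<open>The C*-identity for self-adjoint operators, due to
  \<open>(norm (A \<cdot> x))\<^sup>2\<close> being the quadratic form of
  \<open>A * A\<close>.\<close>

lemma norm_cop_square:
  assumes "adj A = A"
  shows "norm (A * A) = (norm A)\<^sup>2"
proof (rule antisym)
  show "norm (A * A) \<le> (norm A)\<^sup>2" unfolding power2_eq_square by (rule norm_mult_ineq)
  have "norm A \<le> sqrt (norm (A * A))"
  proof (rule norm_cop_bound)
    fix x
    have "(norm (A \<cdot> x))\<^sup>2 \<le> norm (A * A) * (norm x)\<^sup>2"
      using inner_app_le_norm[of "A * A" x] unfolding inner_square[OF assms] .
    then have "norm (A \<cdot> x) \<le> sqrt (norm (A * A) * (norm x)\<^sup>2)" by (rule real_le_rsqrt)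
    also have "\<dots> = sqrt (norm (A * A)) * norm x" unfolding real_sqrt_mult by simp
    finally show "norm (A \<cdot> x) \<le> sqrt (norm (A * A)) * norm x" .
  qed simp
  then have "(norm A)\<^sup>2 \<le> (sqrt (norm (A * A)))\<^sup>2" by (rule power_mono) simp
  then show "(norm A)\<^sup>2 \<le> norm (A * A)" by simp
qed

section \<open>Inverses of operators bounded below\<close>

text \<open>A bound on the quadratic form rather than on \<open>norm (A \<cdot> x)\<close>: for
  \<open>c > 0\<close> and self-adjoint \<open>A\<close> it gives positivity along with
  invertibility.\<close>

definition bounded_below :: "real \<Rightarrow> 'a::complex_hilbert_space cop \<Rightarrow> bool" where
  "bounded_below c A \<longleftrightarrow> (\<forall>x. c * (norm x)\<^sup>2 \<le> (A \<cdot> x) \<bullet> x)"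

text \<open>For \<open>M > norm G\<close> the operator \<open>X = 1 - G / M\<close> lies between 0
  and \<open>1 - c / M\<close>, so its norm is below 1. The fixed point of
  \<open>W = 1 + X * W\<close>, taking the place of the Neumann series, is \<open>M\<close> times
  the inverse.\<close>

lemma pos_inverse_exists:
  fixes G :: "'a::complex_hilbert_space cop"
  assumes G: "adj G = G" "bounded_below c G" "c > 0"
  shows "\<exists>V. pos V \<and> V * G = 1 \<and> G * V = 1 \<and> (\<exists>d>0. bounded_below d V)"
proof -
  have posG: "pos G"
  proof (rule posI[OF G(1)])
    fix x :: 'a
    have "0 \<le> c * (norm x)\<^sup>2" using G(3) by simp
    also have "\<dots> \<le> (G \<cdot> x) \<bullet> x" using G(2) by (simp add: bounded_below_def)
    finally show "0 \<le> (G \<cdot> x) \<bullet> x" .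
  qed
  define M where "M = norm G + 1"
  have M: "M > 0" by (simp add: M_def add_nonneg_pos)
  define X where "X = 1 - (1 / M) *\<^sub>R G"
  have X_inner: "(X \<cdot> x) \<bullet> x = (norm x)\<^sup>2 - ((G \<cdot> x) \<bullet> x) / M" for x
    by (simp add: X_def inner_diff power2_norm_eq_inner)
  \<comment> \<open>On the trivial space \<open>c\<close> may exceed \<open>M\<close>, hence the
    maximum with 0.\<close>
  define q where "q = max 0 (1 - c / M)"
  have q: "0 \<le> q" "q < 1" using M G(3) by (simp_all add: q_def)
  have GM: "(G \<cdot> x) \<bullet> x \<le> M * (norm x)\<^sup>2" for x
    unfolding M_def distrib_right
    using inner_app_le_norm[of G x] zero_le_power2[of "norm x"] by linarith
  have "norm X \<le> q"
  proof (rule pos_norm_le[OF _ _ q(1)])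
    show "pos X"
    proof (rule posI)
      show "adj X = X" by (simp add: X_def G)
      show "0 \<le> (X \<cdot> x) \<bullet> x" for x
        unfolding X_inner using GM[of x] M by (simp add: field_simps)
    qed
    fix x
    have "(X \<cdot> x) \<bullet> x \<le> (norm x)\<^sup>2 - (c * (norm x)\<^sup>2) / M"
      unfolding X_inner using G(2) M by (simp add: bounded_below_def divide_right_mono)
    also have "\<dots> = (1 - c / M) * (norm x)\<^sup>2" by (simp add: algebra_simps)
    also have "\<dots> \<le> q * (norm x)\<^sup>2" by (rule mult_right_mono) (simp_all add: q_def)
    finally show "(X \<cdot> x) \<bullet> x \<le> q * (norm x)\<^sup>2" .
  qed
  have "\<exists>!W. 1 + X * W = W"
  proof (rule banach_fix_type[OF q], intro allI)
    fix A B
    have "norm (X * (A - B)) \<le> q * norm (A - B)"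
      using norm_mult_ineq[of X "A - B"] mult_right_mono[OF \<open>norm X \<le> q\<close>, of "norm (A - B)"] by simp
    then show "dist (1 + X * A) (1 + X * B) \<le> q * dist A B"
      by (simp add: dist_norm right_diff_distrib)
  qed
  then obtain W where W: "1 + X * W = W" by blast
  define V where "V = (1 / M) *\<^sub>R W"
  have GV: "G * V = 1"
    using W M by (simp add: V_def X_def algebra_simps)
  have "adj V * adj G = 1" unfolding adj_mult[symmetric] GV by simp
  then have "adj V * G = 1" by (simp only: G(1))
  have "adj V = adj V * (G * V)" by (simp add: GV)
  also have "\<dots> = V" by (simp only: \<open>adj V * G = 1\<close> mult_1_left flip: mult.assoc)
  finally have sa: "adj V = V" .
  have VG: "V * G = 1" using \<open>adj V * G = 1\<close> sa by simp
  have GVx: "G \<cdot> V \<cdot> x = x" for x using arg_cong[OF GV, of "\<lambda>A. A \<cdot> x"] by simp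
  have Vx: "(V \<cdot> x) \<bullet> x = (G \<cdot> V \<cdot> x) \<bullet> (V \<cdot> x)" for x
    by (simp add: GVx inner_commute)
  have "pos V" by (rule posI[OF sa]) (simp only: Vx pos_inner[OF posG])
  \<comment> \<open>\<open>pos_norm_app\<close> for \<open>G\<close> at \<open>V \<cdot> x\<close>
    bounds \<open>(norm x)\<^sup>2\<close> by \<open>M\<close> times the form of
    \<open>V\<close>.\<close>
  moreover have "bounded_below (1 / M) V"
    unfolding bounded_below_def
  proof
    fix x
    have "(norm x)\<^sup>2 \<le> M * ((V \<cdot> x) \<bullet> x)"
      using pos_norm_app[OF posG GM, of "V \<cdot> x"] by (simp add: GVx inner_commute)
    then show "1 / M * (norm x)\<^sup>2 \<le> (V \<cdot> x) \<bullet> x" using M by (simp add: field_simps)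
  qed
  moreover have "1 / M > 0" using M by simp
  ultimately show ?thesis using VG GV by (intro exI[of _ V] conjI exI[of _ "1 / M"])
qed

lemma closed_cpt: "closed cpt"
proof -
  have "A \<in> cpt" if A: "A \<in> closure cpt" for A :: "'a cop"
  proof (rule cpt_approx)
    fix e :: real assume "e > 0"
    with A obtain K where "K \<in> cpt" "dist K A < e" unfolding closure_approachable by meson
    then show "\<exists>K\<in>cpt. norm (A - K) \<le> e"
      by (intro bexI[of _ K]) (simp_all add: dist_norm norm_minus_commute)
  qed
  then show ?thesis unfolding closure_subset_eq[symmetric] by blast
qed

section \<open>Square roots\<close>

text \<open>
  The iteration converges to \<open>1 - sqrt (1 - B)\<close>; for \<open>norm B \<le> 1\<close> it is dominated, increment by
  increment, by the bounded scalar iteration with \<open>B = 1\<close>.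
\<close>

primrec sqrt_iter :: "'a::real_normed_algebra \<Rightarrow> nat \<Rightarrow> 'a" where
  "sqrt_iter B 0 = 0"
| "sqrt_iter B (Suc n) = (1/2) *\<^sub>R (B + sqrt_iter B n * sqrt_iter B n)"

lemma sqrt_iter_real:
  "0 \<le> sqrt_iter (1::real) n" "sqrt_iter (1::real) n \<le> 1"
  "sqrt_iter (1::real) n \<le> sqrt_iter 1 (Suc n)"
proof -
  show 0: "0 \<le> sqrt_iter (1::real) n" for n by (induction n) auto
  show 1: "sqrt_iter (1::real) n \<le> 1" for n
    by (induction n) (use 0 in \<open>auto simp: mult_le_one\<close>)
  show "sqrt_iter (1::real) n \<le> sqrt_iter 1 (Suc n)"
    using zero_le_power2[of "sqrt_iter (1::real) n - 1"] by (simp add: power2_eq_square algebra_simps)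
qed

lemma norm_sqrt_iter:
  assumes B: "norm B \<le> 1"
  shows "norm (sqrt_iter B n) \<le> sqrt_iter 1 n"
proof (induction n)
  case (Suc n)
  have "norm (sqrt_iter B n * sqrt_iter B n) \<le> sqrt_iter 1 n * sqrt_iter 1 n"
    by (rule order_trans[OF norm_mult_ineq mult_mono[OF Suc Suc sqrt_iter_real(1) norm_ge_zero]])
  then have "norm (B + sqrt_iter B n * sqrt_iter B n) \<le> 1 + sqrt_iter 1 n * sqrt_iter 1 n"
    using B norm_triangle_ineq[of B "sqrt_iter B n * sqrt_iter B n"] by linarith
  then show ?case by simp
qed simp

lemma norm_sqrt_iter_diff:
  assumes B: "norm B \<le> 1"
  shows "norm (sqrt_iter B (Suc n) - sqrt_iter B n) \<le> sqrt_iter 1 (Suc n) - sqrt_iter 1 n"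
proof (induction n)
  case 0
  then show ?case using B by simp
next
  case (Suc n)
  let ?X = "sqrt_iter B" and ?x = "sqrt_iter (1::real)"
  let ?D = "?X (Suc n) - ?X n" and ?d = "?x (Suc n) - ?x n"
  have d: "?d \<ge> 0" using sqrt_iter_real(3)[of n] by simp
  have "?X (Suc (Suc n)) - ?X (Suc n) = (1/2) *\<^sub>R (?X (Suc n) * ?X (Suc n) - ?X n * ?X n)"
    by (simp only: sqrt_iter.simps(2)[of B "Suc n"] sqrt_iter.simps(2)[of B n])
      (simp add: algebra_simps)
  \<comment> \<open>This splitting does not need the iterates to commute, and for the scalar
    iteration it is the same identity, so the two estimates match term by term.\<close>
  also have "?X (Suc n) * ?X (Suc n) - ?X n * ?X n = ?X (Suc n) * ?D + ?D * ?X n"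
    by (simp only: left_diff_distrib right_diff_distrib) simp
  finally have eq: "norm (?X (Suc (Suc n)) - ?X (Suc n)) = (1/2) * norm (?X (Suc n) * ?D + ?D * ?X n)" by simp
  have "norm (?X (Suc n) * ?D + ?D * ?X n) \<le> norm (?X (Suc n)) * norm ?D + norm ?D * norm (?X n)"
    by (rule order_trans[OF norm_triangle_ineq add_mono[OF norm_mult_ineq norm_mult_ineq]])
  also have "\<dots> \<le> ?x (Suc n) * ?d + ?d * ?x n"
    by (intro add_mono mult_mono Suc norm_sqrt_iter B d sqrt_iter_real norm_ge_zero)
  also have "\<dots> = 2 * (?x (Suc (Suc n)) - ?x (Suc n))"
    by (simp only: sqrt_iter.simps(2)[of 1 "Suc n"] sqrt_iter.simps(2)[of 1 n])
      (simp add: algebra_simps)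
  finally have le: "norm (?X (Suc n) * ?D + ?D * ?X n) \<le> 2 * (?x (Suc (Suc n)) - ?x (Suc n))" .
  have half: "a \<le> c" if "a = 1/2 * b" "b \<le> 2 * c" for a b c :: real using that by simp
  show ?case by (rule half[OF eq le])
qed

lemma sqrt_iter_convergent:
  fixes B :: "'a::{real_normed_algebra, banach}"
  assumes B: "norm B \<le> 1"
  shows "convergent (sqrt_iter B)"
proof -
  let ?x = "sqrt_iter (1::real)"
  have "incseq ?x" by (rule incseq_SucI) (rule sqrt_iter_real)
  then have conv: "convergent ?x"
    using sqrt_iter_real(2) by (rule_tac incseq_convergent[of ?x 1]) (auto intro: convergentI)
  have le': "norm (sqrt_iter B m - sqrt_iter B n) \<le> ?x m - ?x n" if "n \<le> m" for m n
    using that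
  proof (induction m rule: dec_induct)
    case (step m)
    show ?case
      using norm_triangle_ineq[of "sqrt_iter B (Suc m) - sqrt_iter B m" "sqrt_iter B m - sqrt_iter B n"]
        norm_sqrt_iter_diff[OF B, of m] step.IH by simp
  qed simp
  have le: "norm (sqrt_iter B m - sqrt_iter B n) \<le> \<bar>?x m - ?x n\<bar>" for m n
    using le'[of n m] le'[of m n] norm_minus_commute[of "sqrt_iter B m" "sqrt_iter B n"]
    by (cases "n \<le> m") auto
  have "Cauchy (sqrt_iter B)"
    unfolding Cauchy_def dist_norm
  proof (intro allI impI)
    fix e :: real assume "e > 0"
    with convergent_Cauchy[OF conv] obtain N where "\<And>m n. m \<ge> N \<Longrightarrow> n \<ge> N \<Longrightarrow> \<bar>?x m - ?x n\<bar> < e"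
      unfolding Cauchy_def dist_real_def by blast
    then show "\<exists>N. \<forall>m\<ge>N. \<forall>n\<ge>N. norm (sqrt_iter B m - sqrt_iter B n) < e"
      by (intro exI[of _ N] allI impI le_less_trans[OF le])
  qed
  then show ?thesis by (rule Cauchy_convergent)
qed

definition sqrt_lim :: "'a::{real_normed_algebra, banach} \<Rightarrow> 'a" where
  "sqrt_lim B = lim (sqrt_iter B)"

lemma sqrt_lim:
  assumes "norm B \<le> 1"
  shows "sqrt_iter B \<longlonglongrightarrow> sqrt_lim B"
  using sqrt_iter_convergent[OF assms] by (simp add: convergent_LIMSEQ_iff sqrt_lim_def)

lemma sqrt_lim_in_closed:
  assumes "norm B \<le> 1" "closed S" "\<And>n. sqrt_iter B n \<in> S"
  shows "sqrt_lim B \<in> S"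
  using closed_sequentially[OF assms(2) assms(3) sqrt_lim[OF assms(1)]] .

lemma sqrt_lim_square:
  assumes "norm B \<le> 1"
  shows "sqrt_lim B * sqrt_lim B = 2 *\<^sub>R sqrt_lim B - B"
proof -
  let ?W = "sqrt_lim B"
  have "(\<lambda>n. sqrt_iter B (Suc n)) \<longlonglongrightarrow> (1/2) *\<^sub>R (B + ?W * ?W)"
    unfolding sqrt_iter.simps by (intro tendsto_intros sqrt_lim assms)
  from LIMSEQ_unique[OF LIMSEQ_Suc[OF sqrt_lim[OF assms]] this]
  have "2 *\<^sub>R ?W = 2 *\<^sub>R ((1/2) *\<^sub>R (B + ?W * ?W))" by (rule arg_cong)
  then show ?thesis by (simp add: algebra_simps)
qed

lemma norm_sqrt_lim:
  assumes "norm B \<le> 1"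
  shows "norm (sqrt_lim B) \<le> 1"
proof -
  have "sqrt_lim B \<in> cball 0 1"
    by (rule sqrt_lim_in_closed[OF assms])
      (auto intro: order_trans[OF norm_sqrt_iter[OF assms] sqrt_iter_real(2)])
  then show ?thesis by simp
qed

lemma sqrt_iter_adj:
  fixes B :: "'a::complex_hilbert_space cop"
  shows "adj B = B \<Longrightarrow> adj (sqrt_iter B n) = sqrt_iter B n"
  by (induction n) auto

lemma sqrt_iter_commute:
  fixes B :: "'a::real_normed_algebra"
  assumes "B * C = C * B"
  shows "sqrt_iter B n * C = C * sqrt_iter B n"
proof (induction n)
  case (Suc n)
  have "sqrt_iter B n * sqrt_iter B n * C = C * (sqrt_iter B n * sqrt_iter B n)"
    by (metis Suc mult.assoc)
  then show ?case using assms by (simp add: distrib_left distrib_right)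
qed simp

lemma scaled_norm_le_one:
  assumes A: "pos A" "norm A \<le> M" "0 < M"
  shows "norm (1 - (1/M) *\<^sub>R A) \<le> 1"
proof (rule pos_norm_le)
  have le: "(A \<cdot> x) \<bullet> x \<le> M * (norm x)\<^sup>2" for x
    by (rule order_trans[OF inner_app_le_norm mult_right_mono[OF A(2)]]) simp
  show "pos (1 - (1/M) *\<^sub>R A)"
  proof (rule posI)
    show "0 \<le> ((1 - (1/M) *\<^sub>R A) \<cdot> x) \<bullet> x" for x
      using le[of x] A(3) by (simp add: inner_diff power2_norm_eq_inner field_simps)
  qed (simp add: pos_adj[OF A(1)])
  show "((1 - (1/M) *\<^sub>R A) \<cdot> x) \<bullet> x \<le> 1 * (norm x)\<^sup>2" for x
    using pos_inner[OF A(1), of x] A(3) by (simp add: inner_diff power2_norm_eq_inner)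
qed simp

text \<open>With \<open>B = 1 - A / M\<close> one has \<open>A = M (1 - B)\<close>, and
  \<open>sqrt_lim B\<close> is \<open>1 - sqrt (1 - B)\<close>. The scale \<open>M\<close> is a
  parameter so that two operators can be treated by the same iteration in
  \<open>psqrt_ceq\<close>.\<close>

definition scaled_sqrt :: "real \<Rightarrow> 'a::complex_hilbert_space cop \<Rightarrow> 'a cop" where
  "scaled_sqrt M A = sqrt M *\<^sub>R (1 - sqrt_lim (1 - (1/M) *\<^sub>R A))"

lemma scaled_sqrt:
  assumes A: "pos A" "norm A \<le> M" "0 < M"
  shows "pos (scaled_sqrt M A)" "scaled_sqrt M A * scaled_sqrt M A = A"
    "A * C = C * A \<Longrightarrow> scaled_sqrt M A * C = C * scaled_sqrt M A"
proof -
  define B where "B = 1 - (1/M) *\<^sub>R A"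
  note B = scaled_norm_le_one[OF A, folded B_def]
  let ?W = "sqrt_lim B"
  have R: "scaled_sqrt M A = sqrt M *\<^sub>R (1 - ?W)" by (simp add: scaled_sqrt_def B_def)
  have "adj B = B" by (simp add: B_def pos_adj[OF A(1)])
  then have "?W \<in> {A. adj A = A}"
    by (intro sqrt_lim_in_closed[OF B closed_selfadjoint]) (simp add: sqrt_iter_adj)
  then have W: "adj ?W = ?W" by simp
  have "pos (1 - ?W)"
  proof (rule posI)
    fix x :: 'a
    have "norm ?W * (norm x)\<^sup>2 \<le> 1 * (norm x)\<^sup>2"
      by (rule mult_right_mono[OF norm_sqrt_lim[OF B]]) simp
    then show "0 \<le> ((1 - ?W) \<cdot> x) \<bullet> x"
      using inner_app_le_norm[of ?W x] by (simp add: inner_diff power2_norm_eq_inner)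
  qed (simp add: W)
  then show "pos (scaled_sqrt M A)" unfolding R using A(3) by (intro pos_scaleR) auto
  have "scaled_sqrt M A * scaled_sqrt M A = M *\<^sub>R ((1 - ?W) * (1 - ?W))"
    unfolding R using A(3) by (simp del: real_sqrt_mult add: real_sqrt_mult_self)
  also have "(1 - ?W) * (1 - ?W) = 1 - B"
    using sqrt_lim_square[OF B] by (simp add: algebra_simps scaleR_2)
  also have "M *\<^sub>R (1 - B) = A" using A(3) by (simp add: B_def)
  finally show "scaled_sqrt M A * scaled_sqrt M A = A" .
  assume "A * C = C * A"
  then have "B * C = C * B" by (simp add: B_def left_diff_distrib right_diff_distrib)
  then have "?W \<in> {X. X * C = C * X}"
    by (intro sqrt_lim_in_closed[OF B] closed_Collect_eq continuous_intros CollectI sqrt_iter_commute)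
  then show "scaled_sqrt M A * C = C * scaled_sqrt M A"
    by (simp add: R left_diff_distrib right_diff_distrib)
qed

text \<open>For \<open>y = (R - S) \<cdot> x\<close> commutation gives
  \<open>(R + S) \<cdot> y = 0\<close>. Both forms then vanish at \<open>y\<close>, so
  \<open>R\<close> and \<open>S\<close> annihilate \<open>y\<close>, and
  \<open>y \<bullet> y = ((R - S) \<cdot> y) \<bullet> x = 0\<close>.\<close>

lemma pos_sqrt_unique_commuting:
  assumes R: "pos R" and S: "pos S" and RS: "R * R = S * S" "R * S = S * R"
  shows "R = S"
proof (rule cop_eqI)
  fix x
  define y where "y = (R - S) \<cdot> x"
  have "(R + S) * (R - S) = 0" using RS by (simp add: algebra_simps)
  then have "(R + S) \<cdot> y = 0" unfolding y_def app_mult[symmetric] by simp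
  then have "(R \<cdot> y) \<bullet> y + (S \<cdot> y) \<bullet> y = 0" by (simp flip: inner_add_left)
  then have "(R \<cdot> y) \<bullet> y = 0" "(S \<cdot> y) \<bullet> y = 0"
    using pos_inner[OF R, of y] pos_inner[OF S, of y] by linarith+
  then have "R \<cdot> y = 0" "S \<cdot> y = 0" using pos_app_eq_zero R S by blast+
  then have "((R - S) \<cdot> y) \<bullet> x = 0" by simp
  then have "y \<bullet> y = 0"
    using selfadjoint_inner[of "R - S" y x] pos_adj[OF R] pos_adj[OF S] by (simp add: y_def)
  then show "R \<cdot> x = S \<cdot> x" by (simp add: y_def)
qed

definition psqrt :: "'a::complex_hilbert_space cop \<Rightarrow> 'a cop" where
  "psqrt A = scaled_sqrt (norm A + 1) A"

lemma norm_plus_one_pos: "0 < norm A + 1"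
  using norm_ge_zero[of A] by linarith

lemma psqrt:
  assumes "pos A"
  shows psqrt_pos: "pos (psqrt A)" and psqrt_square: "psqrt A * psqrt A = A"
    and psqrt_commute: "A * C = C * A \<Longrightarrow> psqrt A * C = C * psqrt A"
  unfolding psqrt_def by (rule scaled_sqrt[OF assms _ norm_plus_one_pos]; simp)+

text \<open>\<open>psqrt A\<close> commutes with whatever commutes with \<open>A\<close>, in
  particular with its root \<open>R\<close>, so uniqueness among commuting roots suffices.\<close>

lemma psqrt_eqI:
  assumes R: "pos R" "R * R = A"
  shows "psqrt A = R"
proof -
  have A: "pos A" using pos_square[OF pos_adj[OF R(1)]] R(2) by simp
  show ?thesis
    by (rule pos_sqrt_unique_commuting[OF psqrt_pos[OF A] R(1)])
      (use R(2) psqrt_square[OF A] in simp, rule psqrt_commute[OF A], use R(2) in \<open>simp add: mult.assoc flip: R(2)\<close>)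
qed

lemma psqrt_eq_scaled_sqrt: "pos A \<Longrightarrow> norm A \<le> M \<Longrightarrow> 0 < M \<Longrightarrow> psqrt A = scaled_sqrt M A"
  by (rule psqrt_eqI) (rule scaled_sqrt; assumption)+

section \<open>Equality modulo compact operators\<close>

definition ceq :: "'a::complex_hilbert_space cop \<Rightarrow> 'a cop \<Rightarrow> bool" (infix \<open>\<doteq>\<close> 50) where
  "A \<doteq> B \<longleftrightarrow> A - B \<in> cpt"

lemma ceq_refl [simp, intro]: "A \<doteq> A"
  by (simp add: ceq_def)

lemma ceq_sym: "A \<doteq> B \<Longrightarrow> B \<doteq> A"
  unfolding ceq_def using cpt_uminus by fastforce

lemma ceq_trans [trans]: "A \<doteq> B \<Longrightarrow> B \<doteq> C \<Longrightarrow> A \<doteq> C"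
  unfolding ceq_def using cpt_add[of "A - B" "B - C"] by simp

lemma ceq_zero_iff: "A \<doteq> 0 \<longleftrightarrow> A \<in> cpt"
  by (simp add: ceq_def)

lemma ceq_add: "A \<doteq> B \<Longrightarrow> C \<doteq> D \<Longrightarrow> A + C \<doteq> B + D"
  unfolding ceq_def using cpt_add[of "A - B" "C - D"] by (simp add: algebra_simps)

lemma ceq_diff: "A \<doteq> B \<Longrightarrow> C \<doteq> D \<Longrightarrow> A - C \<doteq> B - D"
  unfolding ceq_def using cpt_diff[of "A - B" "C - D"] by (simp add: algebra_simps)

lemma ceq_scaleR: "A \<doteq> B \<Longrightarrow> r *\<^sub>R A \<doteq> r *\<^sub>R B"
  unfolding ceq_def using cpt_scaleR[of "A - B" r] by (simp add: scaleR_diff_right)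

lemma ceq_mult:
  assumes "A \<doteq> B" "C \<doteq> D"
  shows "A * C \<doteq> B * D"
proof -
  have "A * C - B * D = (A - B) * C + B * (C - D)" by (simp add: algebra_simps)
  then show ?thesis using assms unfolding ceq_def by (simp add: cpt_add cpt_mult_left cpt_mult_right)
qed

lemma ceq_sum: "(\<And>i. i \<in> I \<Longrightarrow> f i \<doteq> g i) \<Longrightarrow> sum f I \<doteq> sum g I"
  unfolding ceq_def sum_subtractf[symmetric] by (rule cpt_sum)

lemma ceq_adj: "A \<doteq> B \<Longrightarrow> adj A \<doteq> adj B"
  unfolding ceq_def adj_diff[symmetric] by (rule cpt_adj)

text \<open>With a common scale \<open>M\<close> the iterates for \<open>A\<close> and
  \<open>B\<close> agree modulo compact operators at every stage, and the compact operators are norm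
  closed.\<close>

lemma psqrt_ceq:
  assumes A: "pos A" and B: "pos B" and AB: "A \<doteq> B"
  shows "psqrt A \<doteq> psqrt B"
proof -
  define M where "M = norm A + norm B + 1"
  have M: "norm A \<le> M" "norm B \<le> M" "0 < M"
    using norm_ge_zero[of A] norm_ge_zero[of B] by (simp_all add: M_def, linarith)
  let ?X = "1 - (1/M) *\<^sub>R A" and ?Y = "1 - (1/M) *\<^sub>R B"
  have XY: "?X \<doteq> ?Y" by (intro ceq_diff ceq_scaleR AB ceq_refl)
  have "sqrt_iter ?X n \<doteq> sqrt_iter ?Y n" for n
    by (induction n) (auto intro!: ceq_scaleR ceq_add ceq_mult XY)
  then have "sqrt_iter ?X n - sqrt_iter ?Y n \<in> cpt" for n by (simp add: ceq_def)
  then have "sqrt_lim ?X - sqrt_lim ?Y \<in> cpt"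
    by (rule closed_sequentially[OF closed_cpt _ tendsto_diff[OF sqrt_lim sqrt_lim]])
      (intro scaled_norm_le_one A B M)+
  then have "sqrt_lim ?X \<doteq> sqrt_lim ?Y" by (simp add: ceq_def)
  then have "scaled_sqrt M A \<doteq> scaled_sqrt M B"
    unfolding scaled_sqrt_def by (intro ceq_scaleR ceq_diff ceq_refl)
  then show ?thesis using psqrt_eq_scaled_sqrt A B M by metis
qed

section \<open>Essentially positive operators\<close>

text \<open>\<open>psqrt (Z * Z)\<close> is the absolute value of \<open>Z\<close>, so the
  difference is twice the negative part of \<open>Z\<close>, and the hypothesis bounds that part by
  \<open>d\<close>.\<close>

lemma norm_abs_diff_le:
  assumes Z: "adj Z = Z" "pos (Z + d *\<^sub>R 1)" and d: "0 \<le> d"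
  shows "norm (psqrt (Z * Z) - Z) \<le> 2 * d"
proof -
  let ?R = "psqrt (Z * Z)"
  have posZZ: "pos (Z * Z)" by (rule pos_square[OF Z(1)])
  note R = psqrt_pos[OF posZZ] psqrt_square[OF posZZ]
  have comm: "?R * Z = Z * ?R" by (rule psqrt_commute[OF posZZ]) (simp add: mult.assoc)
  \<comment> \<open>Since \<open>D (|Z| + Z) = 0\<close>, one has \<open>0 \<le> D\<^sup>3 = - 2 D Z D \<le> 2 d D\<^sup>2\<close>.\<close>
  define D where "D = ?R - Z"
  have D: "adj D = D" by (simp add: D_def pos_adj[OF R(1)] Z(1))
  have "D * (?R + Z) = 0" using R(2) comm by (simp add: D_def algebra_simps)
  then have DR: "D * ?R = - (D * Z)" by (simp add: distrib_left eq_neg_iff_add_eq_0)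
  have "D * D * D = (D * ?R - D * Z) * D" by (simp add: D_def algebra_simps)
  then have D3: "D * D * D = 2 *\<^sub>R (D * ?R * D)" "D * D * D = - 2 *\<^sub>R (D * Z * D)"
    by (simp_all add: DR scaleR_2 left_diff_distrib)
  have "norm (D * D * D) \<le> 2 * d * (norm D)\<^sup>2"
  proof (rule pos_norm_le)
    show "pos (D * D * D)"
      unfolding D3(1) by (intro pos_scaleR pos_conjugate_selfadjoint R D) simp
    fix x
    let ?y = "D \<cdot> x"
    have "0 \<le> ((Z + d *\<^sub>R 1) \<cdot> ?y) \<bullet> ?y" by (rule pos_inner[OF Z(2)])
    then have "- ((Z \<cdot> ?y) \<bullet> ?y) \<le> d * (norm ?y)\<^sup>2"
      by (simp add: inner_add power2_norm_eq_inner)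
    moreover have "((D * D * D) \<cdot> x) \<bullet> x = - 2 * ((Z \<cdot> ?y) \<bullet> ?y)"
      unfolding D3(2) by (simp add: selfadjoint_inner[OF D, of "Z \<cdot> ?y"])
    ultimately have "((D * D * D) \<cdot> x) \<bullet> x \<le> 2 * d * (norm ?y)\<^sup>2" by simp
    also have "\<dots> \<le> 2 * d * (norm D * norm x)\<^sup>2"
      using d by (intro mult_left_mono power_mono norm_app) auto
    finally show "((D * D * D) \<cdot> x) \<bullet> x \<le> 2 * d * (norm D)\<^sup>2 * (norm x)\<^sup>2"
      by (simp only: power_mult_distrib mult.assoc)
  qed (use d in simp)
  \<comment> \<open>The C*-identity, used for \<open>D\<close> and for \<open>D * D\<close>, makes
    the fourth power of \<open>norm D\<close> the norm of the fourth power of \<open>D\<close>; the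
    bound on the cube then yields one on \<open>norm D\<close>.\<close>
  moreover have "(norm D)\<^sup>2 * (norm D)\<^sup>2 \<le> norm (D * D * D) * norm D"
  proof -
    have DD: "adj (D * D) = D * D" by (simp add: D)
    have "(norm D)\<^sup>2 * (norm D)\<^sup>2 = norm ((D * D) * (D * D))"
      unfolding norm_cop_square[OF DD] norm_cop_square[OF D] by (simp only: power2_eq_square)
    also have "(D * D) * (D * D) = (D * D * D) * D" by (simp only: mult.assoc)
    also have "norm \<dots> \<le> norm (D * D * D) * norm D" by (rule norm_mult_ineq)
    finally show ?thesis .
  qed
  ultimately have "(norm D)\<^sup>2 * (norm D)\<^sup>2 \<le> 2 * d * (norm D)\<^sup>2 * norm D"
    using mult_right_mono[of "norm (D * D * D)" "2 * d * (norm D)\<^sup>2" "norm D"] by simp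
  then have *: "norm D * (norm D * norm D * norm D) \<le> 2 * d * (norm D * norm D * norm D)"
    by (simp only: power2_eq_square mult_ac)
  show ?thesis
  proof (cases "norm D = 0")
    case True
    then show ?thesis using d by (simp add: D_def)
  next
    case False
    then have "norm D > 0" by simp
    then have "norm D \<le> 2 * d" by (intro mult_right_le_imp_le[OF *]) simp
    then show ?thesis by (simp add: D_def)
  qed
qed

text \<open>Modulo compact operators \<open>psqrt (Y * Y) - Y\<close> is
  \<open>psqrt (Z * Z) - Z\<close>, of norm at most \<open>2 * d\<close>; as \<open>d\<close> is
  arbitrary it is a norm limit of compact operators. This replaces an essentially positive operator
  by a positive one.\<close>

lemma essentially_positive_ceq_abs:
  assumes Y: "adj Y = Y" and ess: "\<And>d. d > 0 \<Longrightarrow> \<exists>Z. adj Z = Z \<and> Z \<doteq> Y \<and> pos (Z + d *\<^sub>R 1)"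
  shows "psqrt (Y * Y) \<doteq> Y"
  unfolding ceq_def
proof (rule cpt_approx)
  fix e :: real assume "e > 0"
  then obtain Z where Z: "adj Z = Z" "Z \<doteq> Y" "pos (Z + (e/2) *\<^sub>R 1)" using ess[of "e/2"] by auto
  have "psqrt (Y * Y) - Y \<doteq> psqrt (Z * Z) - Z"
    by (intro ceq_diff psqrt_ceq pos_square ceq_mult Y Z ceq_sym[OF Z(2)])
  moreover have "norm (psqrt (Z * Z) - Z) \<le> e"
    using norm_abs_diff_le[OF Z(1,3)] \<open>e > 0\<close> by simp
  ultimately show "\<exists>K\<in>cpt. norm (psqrt (Y * Y) - Y - K) \<le> e"
    unfolding ceq_def by (intro bexI[of _ "psqrt (Y * Y) - Y - (psqrt (Z * Z) - Z)"]) auto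
qed

lemma cpt_compact:
  assumes "K \<in> cpt"
  shows "compact (closure (app K ` cball 0 1))"
  using assms by (simp add: cpt_def compact_ops_def app.rep_eq)

text \<open>Otherwise there are unit vectors \<open>y n\<close> with \<open>B \<cdot> y n\<close>
  tending to 0. Since \<open>B * B - 1\<close> is compact, a subsequence of \<open>y\<close>
  converges, and its limit is a unit vector in the kernel of \<open>B\<close>.\<close>

lemma injective_symmetry_bounded_below:
  fixes B :: "'a::complex_hilbert_space cop"
  assumes B: "adj B = B" "B * B \<doteq> 1" and inj: "\<And>x. B \<cdot> x = 0 \<Longrightarrow> x = 0"
  shows "\<exists>c>0. bounded_below c (B * B)"
proof (rule ccontr)
  assume neg: "\<not> ?thesis"
  have "\<exists>y. norm y = 1 \<and> norm (B \<cdot> y) < 1 / real (Suc n)" for n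
  proof -
    let ?c = "(1 / real (Suc n))\<^sup>2"
    have "\<not> bounded_below ?c (B * B)" using neg by (metis zero_less_divide_1_iff of_nat_0_less_iff zero_less_Suc zero_less_power)
    then obtain x where x: "(norm (B \<cdot> x))\<^sup>2 < ?c * (norm x)\<^sup>2"
      unfolding bounded_below_def inner_square[OF B(1)] by (auto simp: not_le)
    then have x0: "norm x > 0" by (cases "x = 0") auto
    have "(norm (B \<cdot> x))\<^sup>2 < (1 / real (Suc n) * norm x)\<^sup>2" using x by (simp only: power_mult_distrib)
    then have "norm (B \<cdot> x) < 1 / real (Suc n) * norm x" by (rule power2_less_imp_less) simp
    then have "norm (B \<cdot> ((1 / norm x) *\<^sub>R x)) < 1 / real (Suc n)"
      using x0 by (simp add: field_simps)
    moreover have "norm ((1 / norm x) *\<^sub>R x) = 1" using x0 by simp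
    ultimately show ?thesis by blast
  qed
  then obtain y where y: "\<And>n. norm (y n) = 1" "\<And>n. norm (B \<cdot> y n) < 1 / real (Suc n)" by metis
  have By: "(\<lambda>n. B \<cdot> y n) \<longlonglongrightarrow> 0"
    by (rule Lim_null_comparison[OF _ LIMSEQ_Suc[OF lim_1_over_n]])
      (use y(2) in \<open>auto intro!: always_eventually less_imp_le\<close>)
  let ?K = "B * B - 1"
  have "compact (closure (app ?K ` cball 0 1))" using B(2) by (intro cpt_compact) (simp add: ceq_def)
  moreover have "?K \<cdot> y n \<in> closure (app ?K ` cball 0 1)" for n
    by (rule subsetD[OF closure_subset]) (use y(1)[of n] in auto)
  ultimately obtain l r where r: "strict_mono r" "((\<lambda>n. ?K \<cdot> y n) \<circ> r) \<longlonglongrightarrow> l"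
    using compact_imp_seq_compact unfolding seq_compact_def by metis
  have Br: "(\<lambda>n. B \<cdot> y (r n)) \<longlonglongrightarrow> 0" using LIMSEQ_subseq_LIMSEQ[OF By r(1)] by (simp add: o_def)
  have BBr: "(\<lambda>n. B \<cdot> B \<cdot> y (r n)) \<longlonglongrightarrow> B \<cdot> 0" by (intro app.tendsto Br tendsto_const)
  have "(\<lambda>n. B \<cdot> B \<cdot> y (r n) - ?K \<cdot> y (r n)) \<longlonglongrightarrow> B \<cdot> 0 - l"
    by (rule tendsto_diff[OF BBr]) (use r(2) in \<open>simp add: o_def\<close>)
  then have yr: "(\<lambda>n. y (r n)) \<longlonglongrightarrow> - l" by simp
  have "(\<lambda>n. B \<cdot> y (r n)) \<longlonglongrightarrow> B \<cdot> (- l)" by (intro app.tendsto yr tendsto_const)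
  then have "B \<cdot> (- l) = 0" using Br LIMSEQ_unique by blast
  then have "- l = 0" by (rule inj)
  moreover have "(\<lambda>n. norm (y (r n))) \<longlonglongrightarrow> norm (- l)" by (rule tendsto_norm[OF yr])
  ultimately show False by (simp add: y(1) LIMSEQ_const_iff)
qed

section \<open>Lifting projections\<close>

text \<open>The condition on \<open>e\<close> is carried from \<open>B\<close> to \<open>U\<close>
  so that, when projections are lifted one by one, a new one stays orthogonal to those already
  found.\<close>

lemma lift_symmetry:
  fixes B e :: "'a::complex_hilbert_space cop"
  assumes B: "adj B = B" "B * B \<doteq> 1" and e: "B * e = - e"
  shows "\<exists>U. adj U = U \<and> U * U = 1 \<and> U \<doteq> B \<and> U * e = - e"
proof -
  have "\<exists>N. adj N = N \<and> (\<forall>x. N \<cdot> x \<in> {x. B \<cdot> x = 0}) \<and> (\<forall>x\<in>{x. B \<cdot> x = 0}. N \<cdot> x = x)"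
    by (rule orthogonal_projection_exists)
      (auto simp: subspace_def intro!: closed_Collect_eq continuous_intros app.continuous_on)
  then obtain N where N: "adj N = N" "\<And>x. B \<cdot> N \<cdot> x = 0" "\<And>x. B \<cdot> x = 0 \<Longrightarrow> N \<cdot> x = x" by auto
  have BN: "B * N = 0" by (rule cop_eqI) (simp add: N)
  have NB: "N * B = 0" using arg_cong[OF BN, of adj] by (simp add: N B)
  have NN: "N * N = N" by (rule cop_eqI) (simp add: N)
  have "1 * N \<doteq> B * B * N" by (intro ceq_mult ceq_sym[OF B(2)] ceq_refl)
  then have N0: "N \<doteq> 0" by (simp add: mult.assoc BN)
  \<comment> \<open>Adding the (compact) projection onto the kernel opens a gap in the spectrum at \<open>0\<close>; the
    symmetry \<open>U\<close> is the sign of \<open>B + N\<close>.\<close>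
  define C where "C = B + N"
  have adjC: "adj C = C" by (simp add: C_def N B)
  have CC: "C * C = B * B + N" by (simp add: C_def algebra_simps BN NB NN)
  have CC1: "C * C \<doteq> 1" using ceq_add[OF B(2) N0] by (simp add: CC)
  have "N * e = - (N * B * e)" by (simp add: mult.assoc e)
  then have Ce: "C * e = - e" by (simp add: C_def distrib_right e NB)
  have inj: "x = 0" if "C \<cdot> x = 0" for x
  proof -
    have "B \<cdot> (B \<cdot> x + N \<cdot> x) = 0" using that by (simp only: C_def app.add_left app.zero_right)
    then have "((B * B) \<cdot> x) \<bullet> x = 0" by (simp add: N)
    then have "B \<cdot> x = 0" by (simp only: inner_square[OF B(1)] power_eq_0_iff norm_eq_zero)
    with N(3) that show ?thesis by (simp add: C_def)
  qed
  obtain c where c: "c > 0" "bounded_below c (C * C)"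
    using injective_symmetry_bounded_below[OF adjC CC1 inj] by auto
  have "adj (C * C) = C * C" by (simp add: adjC)
  from pos_inverse_exists[OF this c(2,1)] obtain H
    where H: "pos H" "H * (C * C) = 1" "(C * C) * H = 1" by auto
  \<comment> \<open>As \<open>H\<close> inverts \<open>C * C\<close>, this is the inverse of the
    absolute value of \<open>C\<close>, and \<open>V * C\<close> is the sign of
    \<open>C\<close>.\<close>
  define V where "V = psqrt H"
  have V: "pos V" "V * V = H" using psqrt_pos[OF H(1)] psqrt_square[OF H(1)] by (simp_all add: V_def)
  have "H * C = H * C * ((C * C) * H)" by (simp add: H(3))
  also have "\<dots> = (H * (C * C)) * (C * H)" by (simp only: mult.assoc)
  also have "\<dots> = C * H" by (simp add: H(2))
  finally have VC: "V * C = C * V" unfolding V_def by (rule psqrt_commute[OF H(1)])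
  have "H * 1 \<doteq> H * (C * C)" by (intro ceq_mult ceq_refl ceq_sym[OF CC1])
  then have "psqrt H \<doteq> psqrt 1" by (intro psqrt_ceq H pos_one) (simp add: H(2))
  moreover have "psqrt (1 :: 'a cop) = 1" by (rule psqrt_eqI) (simp_all add: pos_one)
  ultimately have V1: "V \<doteq> 1" by (simp add: V_def)
  have "adj (V * C) = V * C" by (simp add: pos_adj[OF V(1)] adjC VC)
  moreover have "(V * C) * (V * C) = 1"
  proof -
    have "(V * C) * (V * C) = V * (C * V) * C" by (simp only: mult.assoc)
    also have "\<dots> = V * V * (C * C)" by (simp only: VC[symmetric] mult.assoc)
    also have "\<dots> = 1" by (simp only: V(2) H(2))
    finally show ?thesis .
  qed
  moreover have "V * C \<doteq> B" using ceq_mult[OF V1 ceq_add[OF ceq_refl N0, of B]] by (simp add: C_def)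
  moreover have "(V * C) * e = - e"
  proof -
    have "C * C * e = e" by (simp add: mult.assoc Ce)
    have "H * e = H * (C * C * e)" by (simp only: \<open>C * C * e = e\<close>)
    also have "\<dots> = H * (C * C) * e" by (simp only: mult.assoc)
    finally have "H * e = e" by (simp add: H(2))
    then have VVe: "V * (V * e) = e" by (simp add: V(2) flip: mult.assoc)
    \<comment> \<open>From \<open>V * V * e = e\<close> it follows that \<open>V + 1\<close>
      annihilates the range of \<open>V * e - e\<close>, and \<open>V + 1\<close> is injective
      because \<open>V\<close> is positive.\<close>
    have "V * e - e = 0"
    proof (rule cop_eqI)
      fix x
      define y where "y = (V * e - e) \<cdot> x"
      have "(V + 1) * (V * e - e) = 0" by (simp add: algebra_simps VVe)
      then have "(V + 1) \<cdot> y = 0" unfolding y_def app_mult[symmetric] by simp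
      then have "((V + 1) \<cdot> y) \<bullet> y = 0" by simp
      then have "(V \<cdot> y) \<bullet> y + y \<bullet> y = 0" by (simp add: inner_add_left)
      then have "y \<bullet> y = 0" using pos_inner[OF V(1), of y] inner_ge_zero[of y] by linarith
      then show "(V * e - e) \<cdot> x = 0 \<cdot> x" by (simp add: y_def)
    qed
    then show ?thesis by (simp add: mult.assoc Ce)
  qed
  ultimately show ?thesis by blast
qed

text \<open>Induction: \<open>B k\<close> is compressed by \<open>Q\<close>, the complement of the
  projections already lifted. Then \<open>S = 2 Q (B k) Q - 1\<close> is an essential symmetry equal
  to -1 on the range of \<open>1 - Q\<close>; its lift \<open>U\<close> has the same value there, so
  the projection \<open>(1 + U) / 2\<close> lies under \<open>Q\<close>.\<close>

lemma lift_orthogonal_projections: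
  fixes B :: "'i \<Rightarrow> 'a::complex_hilbert_space cop"
  assumes "finite I"
    and "\<And>i. i \<in> I \<Longrightarrow> adj (B i) = B i" "\<And>i. i \<in> I \<Longrightarrow> B i * B i \<doteq> B i"
    and "\<And>i j. i \<in> I \<Longrightarrow> j \<in> I \<Longrightarrow> i \<noteq> j \<Longrightarrow> B i * B j \<doteq> 0"
  shows "\<exists>P. (\<forall>i\<in>I. adj (P i) = P i \<and> P i \<doteq> B i) \<and> (\<forall>i\<in>I. \<forall>j\<in>I. P i * P j = (if i = j then P i else 0))"
  using assms
proof (induction I rule: finite_induct)
  case (insert k I)
  have "\<exists>P. (\<forall>i\<in>I. adj (P i) = P i \<and> P i \<doteq> B i) \<and> (\<forall>i\<in>I. \<forall>j\<in>I. P i * P j = (if i = j then P i else 0))"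
    by (rule insert.IH) (simp_all add: insert.prems)
  then obtain P where P': "\<forall>i\<in>I. adj (P i) = P i \<and> P i \<doteq> B i"
    "\<forall>i\<in>I. \<forall>j\<in>I. P i * P j = (if i = j then P i else 0)" by (elim exE conjE) (rule that)
  have P: "adj (P i) = P i" "P i \<doteq> B i" if "i \<in> I" for i using P'(1) that by simp_all
  have PP: "P i * P j = (if i = j then P i else 0)" if "i \<in> I" "j \<in> I" for i j
    using P'(2) that by simp
  define Q where "Q = 1 - sum P I"
  have adjQ: "adj Q = Q" by (simp add: Q_def P)
  have QP: "Q * P i = 0" if "i \<in> I" for i
  proof -
    have "sum P I * P i = (\<Sum>j\<in>I. if j = i then P i else 0)"
      unfolding sum_distrib_right using PP that by (intro sum.cong) auto
    then show ?thesis using that insert.hyps(1) by (simp add: Q_def left_diff_distrib)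
  qed
  have "Q * Q = Q * 1 - (\<Sum>i\<in>I. Q * P i)"
    by (subst (2) Q_def) (simp add: right_diff_distrib sum_distrib_left)
  then have QQ: "Q * Q = Q" by (simp add: QP)
  have Bk: "adj (B k) = B k" "B k * B k \<doteq> B k" using insert.prems by auto
  have "(\<Sum>i\<in>I. P i * B k) \<doteq> (\<Sum>i\<in>I. 0)"
  proof (rule ceq_sum)
    fix i assume i: "i \<in> I"
    have "P i * B k \<doteq> B i * B k" by (intro ceq_mult P(2) i ceq_refl)
    also have "\<dots> \<doteq> 0" using insert.prems(3)[of i k] insert.hyps(2) i by auto
    finally show "P i * B k \<doteq> 0" .
  qed
  then have QB: "Q * B k \<doteq> B k"
    using ceq_diff[OF ceq_refl, of "\<Sum>i\<in>I. P i * B k" "\<Sum>i\<in>I. 0" "B k"]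
    by (simp add: Q_def left_diff_distrib sum_distrib_right)
  have BQ: "B k * Q \<doteq> B k" using ceq_adj[OF QB] by (simp add: Bk adjQ)
  define B0 where "B0 = Q * B k * Q"
  have B0: "B0 \<doteq> B k" unfolding B0_def by (rule ceq_trans[OF ceq_mult[OF QB ceq_refl] BQ])
  have adjB0: "adj B0 = B0" by (simp add: B0_def adjQ Bk mult.assoc)
  have "B0 * B0 \<doteq> B k * B k" by (rule ceq_mult[OF B0 B0])
  also note Bk(2)
  also note ceq_sym[OF B0]
  finally have B00: "B0 * B0 \<doteq> B0" .
  define S where "S = 2 *\<^sub>R B0 - 1"
  have adjS: "adj S = S" by (simp add: S_def adjB0)
  have "S * S = 4 *\<^sub>R (B0 * B0 - B0) + 1"
    by (simp add: S_def algebra_simps flip: scaleR_add_left)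
  also have "\<dots> \<doteq> 4 *\<^sub>R (B0 - B0) + 1"
    by (intro ceq_add ceq_scaleR ceq_diff B00 ceq_refl)
  finally have SS: "S * S \<doteq> 1" by simp
  have Se: "S * (1 - Q) = - (1 - Q)"
    by (simp add: S_def B0_def algebra_simps QQ)
  obtain U where U: "adj U = U" "U * U = 1" "U \<doteq> S" "U * (1 - Q) = - (1 - Q)"
    using lift_symmetry[OF adjS SS Se] by blast
  define R where "R = (1/2) *\<^sub>R (1 + U)"
  have adjR: "adj R = R" by (simp add: R_def U)
  have RR: "R * R = R"
    by (simp add: R_def algebra_simps U flip: scaleR_add_left)
  have "R * (1 - Q) = (1/2) *\<^sub>R ((1 - Q) + U * (1 - Q))" by (simp only: R_def mult_scaleR_left distrib_right mult_1_left)
  then have "R * (1 - Q) = 0" by (simp add: U(4))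
  then have RQ: "R * Q = R" by (simp add: right_diff_distrib)
  have RP: "R * P i = 0" if "i \<in> I" for i
  proof -
    have "R * P i = R * (Q * P i)" by (simp only: RQ flip: mult.assoc)
    then show ?thesis by (simp add: QP[OF that])
  qed
  have PR: "P i * R = 0" if "i \<in> I" for i
    using arg_cong[OF RP[OF that], of adj] by (simp add: adjR P(1) that)
  have "R \<doteq> (1/2) *\<^sub>R (1 + S)" unfolding R_def by (intro ceq_scaleR ceq_add ceq_refl U)
  also have "(1/2) *\<^sub>R (1 + S) = B0" by (simp add: S_def)
  also note B0
  finally have RB: "R \<doteq> B k" .
  show ?case
    by (rule exI[of _ "P(k := R)"]) (use insert.hyps(2) adjR RB RR RP PR P PP in simp)
qed simp

section \<open>Polynomials of operators\<close>

definition peval :: "real poly \<Rightarrow> 'a::complex_hilbert_space cop \<Rightarrow> 'a cop" where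
  "peval p T = (\<Sum>k\<le>degree p. coeff p k *\<^sub>R T ^ k)"

lemma op_power_Rep_cop: "op_power (Rep_cop T) k = Rep_cop (T ^ k)"
  by (induction k) (simp_all add: op_power_def one_cop.rep_eq times_cop.rep_eq)

lemma Rep_cop_sum: "Rep_cop (sum f I) = (\<Sum>i\<in>I. Rep_cop (f i))"
  by (induction I rule: infinite_finite_induct) (simp_all add: zero_cop.rep_eq plus_cop.rep_eq)

lemma op_poly_Rep_cop: "op_poly p (Rep_cop T) = Rep_cop (peval p T)"
  by (simp add: op_poly_def peval_def Rep_cop_sum scaleR_cop.rep_eq op_power_Rep_cop)

lemma peval_bound: "degree p \<le> n \<Longrightarrow> peval p T = (\<Sum>k\<le>n. coeff p k *\<^sub>R T ^ k)"
  unfolding peval_def by (rule sum.mono_neutral_left) (auto simp: coeff_eq_0)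

lemma peval_zero [simp]: "peval 0 T = 0"
  by (simp add: peval_def)

lemma peval_pCons: "peval (pCons a p) T = a *\<^sub>R 1 + T * peval p T"
proof -
  have "peval (pCons a p) T = (\<Sum>k\<le>Suc (degree p). coeff (pCons a p) k *\<^sub>R T ^ k)"
    by (rule peval_bound) (simp add: degree_pCons_le)
  also have "\<dots> = a *\<^sub>R 1 + (\<Sum>k\<le>degree p. coeff p k *\<^sub>R T ^ Suc k)"
    by (subst sum.atMost_Suc_shift) simp
  finally show ?thesis by (simp add: peval_def sum_distrib_left)
qed

lemma peval_one [simp]: "peval 1 T = 1"
  by (simp add: one_pCons peval_pCons)

lemma peval_add: "peval (p + q) T = peval p T + peval q T"
proof -
  define n where "n = max (degree p) (degree q)"
  have "degree p \<le> n" "degree q \<le> n" "degree (p + q) \<le> n"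
    by (auto simp: n_def degree_add_le_max)
  then show ?thesis by (simp add: peval_bound[of _ n] scaleR_add_left sum.distrib)
qed

lemma peval_smult: "peval (smult a p) T = a *\<^sub>R peval p T"
  using peval_bound[OF degree_smult_le[of a p], of T] by (simp add: peval_def scaleR_sum_right)

lemma peval_diff: "peval (p - q) T = peval p T - peval q T"
  using peval_add[of p "smult (-1) q" T] peval_smult[of "-1" q T] by simp

lemma peval_sum: "peval (sum f I) T = (\<Sum>i\<in>I. peval (f i) T)"
  by (induction I rule: infinite_finite_induct) (simp_all add: peval_add)

lemma peval_mult: "peval (p * q) T = peval p T * peval q T"
proof (induction p)
  case (pCons a p)
  have "peval (pCons a p * q) T = a *\<^sub>R peval q T + T * peval (p * q) T"
    by (simp add: mult_pCons_left peval_add peval_smult peval_pCons)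
  then show ?case by (simp add: pCons.IH peval_pCons distrib_right mult.assoc)
qed simp

lemma peval_X: "peval [:0, 1:] T = T"
  by (simp add: peval_pCons)

lemma peval_eigen:
  assumes "T * P = t *\<^sub>R P"
  shows "peval p T * P = poly p t *\<^sub>R P"
proof (induction p)
  case (pCons a p)
  have "peval (pCons a p) T * P = a *\<^sub>R P + T * (peval p T * P)"
    by (simp add: peval_pCons distrib_right mult.assoc)
  then show ?case by (simp add: pCons.IH assms scaleR_add_left mult.commute)
qed simp

lemma peval_eq_zero_of_spectral_sum:
  assumes "sum P I = 1" "\<And>i. i \<in> I \<Longrightarrow> T * P i = t i *\<^sub>R P i" "\<And>i. i \<in> I \<Longrightarrow> poly p (t i) = 0"
  shows "peval p T = 0"
proof -
  have "peval p T = (\<Sum>i\<in>I. peval p T * P i)" by (simp add: assms(1) flip: sum_distrib_left)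
  also have "\<dots> = 0" by (intro sum.neutral) (simp add: peval_eigen[OF assms(2)] assms(3))
  finally show ?thesis .
qed

lemma prod_linear_dvd:
  fixes t :: "'i \<Rightarrow> 'a::field"
  assumes "finite I" "inj_on t I" "\<And>i. i \<in> I \<Longrightarrow> poly q (t i) = 0"
  shows "(\<Prod>i\<in>I. [:- t i, 1:]) dvd q"
  using assms
proof (induction I rule: finite_induct)
  case (insert k I)
  then obtain r where r: "q = (\<Prod>i\<in>I. [:- t i, 1:]) * r" by (auto simp: dvd_def)
  have "t k \<noteq> t i" if "i \<in> I" for i using insert.prems(1) insert.hyps(2) that by auto
  then have "poly (\<Prod>i\<in>I. [:- t i, 1:]) (t k) \<noteq> 0"
    using insert.hyps(1) by (simp add: poly_prod)
  then have "poly r (t k) = 0" using insert.prems(2)[of k] by (simp add: r)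
  then obtain s where s: "r = [:- t k, 1:] * s" by (auto simp: poly_eq_0_iff_dvd dvd_def)
  show ?case
    by (rule dvdI[of _ _ s]) (simp only: r s prod.insert[OF insert.hyps] mult_ac)
qed simp

section \<open>Lagrange idempotents\<close>

text \<open>The sum minus 1 vanishes at all nodes, so it is divisible by a polynomial of degree
  \<open>card I\<close>, while its own degree is smaller.\<close>

lemma Lagrange_basis_exists:
  fixes t :: "'i \<Rightarrow> real"
  assumes I: "finite I" "I \<noteq> {}" and t: "inj_on t I"
  shows "\<exists>l. (\<Sum>i\<in>I. l i) = 1 \<and> (\<forall>i\<in>I. \<forall>j\<in>I. poly (l i) (t j) = (if i = j then 1 else 0))"
proof -
  define m where "m i = (\<Prod>j\<in>I - {i}. [:- t j, 1:])" for i
  define l where "l i = smult (1 / poly (m i) (t i)) (m i)" for i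
  have m0: "poly (m i) (t i) \<noteq> 0" if "i \<in> I" for i
    using I(1) t that by (auto simp: m_def poly_prod inj_on_def)
  have m1: "poly (m i) (t j) = 0" if "i \<in> I" "j \<in> I" "i \<noteq> j" for i j
    using I(1) that by (auto simp: m_def poly_prod intro!: prod_zero bexI[of _ j])
  have l: "poly (l i) (t j) = (if i = j then 1 else 0)" if "i \<in> I" "j \<in> I" for i j
    using m0[OF that(1)] m1[OF that] by (cases "i = j") (simp_all add: l_def)
  have deg: "degree (l i) < card I" if "i \<in> I" for i
  proof -
    have "degree (m i) \<le> (\<Sum>j\<in>I - {i}. degree [:- t j, 1:])"
      using degree_prod_sum_le[of "I - {i}" "\<lambda>j. [:- t j, 1:]"] I(1) unfolding m_def o_def by blast
    also have "\<dots> < card I" using I that by (simp add: card_gt_0_iff)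
    finally show ?thesis using degree_smult_le[of _ "m i"] by (simp add: l_def)
  qed
  define q where "q = (\<Sum>i\<in>I. l i) - 1"
  have "poly q (t j) = 0" if "j \<in> I" for j
    using I(1) that l by (simp add: q_def poly_sum)
  then have dvd: "(\<Prod>i\<in>I. [:- t i, 1:]) dvd q" by (intro prod_linear_dvd I t)
  have card: "card I > 0" using I by (simp add: card_gt_0_iff)
  have "degree (\<Sum>i\<in>I. l i) < card I"
    using deg card by (rule degree_sum_less)
  then have "degree q < card I" unfolding q_def using card by (intro degree_diff_less) simp_all
  moreover have "degree (\<Prod>i\<in>I. [:- t i, 1:]) = card I"
    by (subst degree_prod_eq_sum_degree) simp_all
  ultimately have "q = 0" using dvd_imp_degree_le[OF dvd] by (cases "q = 0") auto
  then show ?thesis using l by (intro exI[of _ l]) (simp add: q_def)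
qed

text \<open>Polynomials agreeing at the nodes differ by a multiple of the given product, so their
  values at \<open>T\<close> agree modulo compact operators. The relations for
  \<open>E i = peval (l i) T\<close> thus only need checking at the nodes.\<close>

lemma essential_spectral_idempotents:
  fixes T :: "'a::complex_hilbert_space cop"
  assumes I: "finite I" "I \<noteq> {}" and t: "inj_on t I"
    and p: "peval (\<Prod>i\<in>I. [:- t i, 1:]) T \<in> cpt"
  shows "\<exists>E. sum E I = 1 \<and> T \<doteq> (\<Sum>i\<in>I. t i *\<^sub>R E i) \<and>
    (\<forall>i\<in>I. \<forall>j\<in>I. E i * E j \<doteq> (if i = j then E i else 0))"
proof -
  obtain l where l: "(\<Sum>i\<in>I. l i) = 1" "\<And>i j. i \<in> I \<Longrightarrow> j \<in> I \<Longrightarrow> poly (l i) (t j) = (if i = j then 1 else 0)"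
    using Lagrange_basis_exists[OF I t] by metis
  have ceqI: "peval q T \<doteq> peval r T" if qr: "\<And>i. i \<in> I \<Longrightarrow> poly q (t i) = poly r (t i)" for q r
  proof -
    have "(\<Prod>i\<in>I. [:- t i, 1:]) dvd q - r" by (rule prod_linear_dvd[OF I(1) t]) (simp add: qr)
    then obtain s where "q - r = (\<Prod>i\<in>I. [:- t i, 1:]) * s" by (auto simp: dvd_def)
    then have "peval (q - r) T \<in> cpt" using p by (simp add: peval_mult cpt_mult_right)
    then show ?thesis by (simp add: ceq_def peval_diff)
  qed
  define E where "E i = peval (l i) T" for i
  have "sum E I = 1" by (simp add: E_def l(1) flip: peval_sum)
  moreover have "T \<doteq> (\<Sum>i\<in>I. t i *\<^sub>R E i)"
  proof -
    have "peval [:0, 1:] T \<doteq> peval (\<Sum>i\<in>I. smult (t i) (l i)) T"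
    proof (rule ceqI)
      fix j assume j: "j \<in> I"
      have "(\<Sum>i\<in>I. t i * poly (l i) (t j)) = (\<Sum>i\<in>I. if i = j then t j else 0)"
        using l(2) j by (intro sum.cong) auto
      then show "poly [:0, 1:] (t j) = poly (\<Sum>i\<in>I. smult (t i) (l i)) (t j)"
        using I(1) j by (simp add: poly_sum)
    qed
    then show ?thesis by (simp add: peval_X peval_sum peval_smult E_def)
  qed
  moreover have "E i * E j \<doteq> (if i = j then E i else 0)" if "i \<in> I" "j \<in> I" for i j
  proof -
    have "peval (l i * l j) T \<doteq> peval (if i = j then l i else 0) T"
      by (rule ceqI) (use that l(2) in auto)
    then show ?thesis by (cases "i = j") (simp_all add: peval_mult E_def)
  qed
  ultimately show ?thesis by blast
qed

section \<open>The self-adjoint model\<close>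

text \<open>As \<open>x\<close> is the sum of the \<open>E i \<cdot> x\<close>, Cauchy-Schwarz over
  \<open>card I\<close> terms bounds \<open>(norm x)\<^sup>2\<close>.\<close>

lemma adj_mult_self_sum_bounded_below:
  fixes E :: "'i \<Rightarrow> 'a::complex_hilbert_space cop"
  assumes I: "finite I" "I \<noteq> {}" and E: "sum E I = 1"
  shows "bounded_below (1 / card I) (\<Sum>i\<in>I. adj (E i) * E i)"
  unfolding bounded_below_def
proof
  fix x
  have card: "real (card I) > 0" using I by (simp add: card_gt_0_iff)
  have "norm x = norm (sum E I \<cdot> x)" by (simp add: E del: app_simps)
  also have "\<dots> = norm (\<Sum>i\<in>I. E i \<cdot> x)" by simp
  also have "\<dots> \<le> (\<Sum>i\<in>I. norm (E i \<cdot> x))" by (rule norm_sum)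
  finally have "(norm x)\<^sup>2 \<le> (\<Sum>i\<in>I. norm (E i \<cdot> x))\<^sup>2" by (rule power_mono) simp
  also have "\<dots> \<le> (\<Sum>i\<in>I. (norm (E i \<cdot> x))\<^sup>2) * card I" by (rule sum_squared_le_sum_of_squares)
  also have "(\<Sum>i\<in>I. (norm (E i \<cdot> x))\<^sup>2) = ((\<Sum>i\<in>I. adj (E i) * E i) \<cdot> x) \<bullet> x"
    by (simp add: inner_sum_left inner_adj_left power2_norm_eq_inner)
  finally show "1 / card I * (norm x)\<^sup>2 \<le> ((\<Sum>i\<in>I. adj (E i) * E i) \<cdot> x) \<bullet> x"
    using card by (simp add: field_simps)
qed

lemma orthogonal_model_exists:
  fixes T :: "'a::complex_hilbert_space cop" and t :: "'i \<Rightarrow> real"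
  assumes I: "finite I" "I \<noteq> {}" and one: "(1 :: 'a cop) \<notin> cpt"
    and E: "sum E I = 1" "T \<doteq> (\<Sum>i\<in>I. t i *\<^sub>R E i)"
      "\<forall>i\<in>I. \<forall>j\<in>I. E i * E j \<doteq> (if i = j then E i else 0)"
  shows "\<exists>V W P J c. pos V \<and> adj W = W \<and> V * W = 1 \<and> W * V = 1 \<and> c > 0 \<and> bounded_below c (V * V) \<and>
    J \<subseteq> I \<and> (\<forall>i\<in>J. adj (P i) = P i \<and> P i \<notin> cpt) \<and>
    (\<forall>i\<in>J. \<forall>j\<in>J. P i * P j = (if i = j then P i else 0)) \<and> sum P J = 1 \<and>
    T \<doteq> V * (\<Sum>i\<in>J. t i *\<^sub>R P i) * W"
proof -
  have EE: "E i * E j \<doteq> (if i = j then E i else 0)" if "i \<in> I" "j \<in> I" for i j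
    using E(3) that by blast
  define G where "G = (\<Sum>i\<in>I. adj (E i) * E i)"
  have adjG: "adj G = G" by (simp add: G_def)
  have "1 / real (card I) > 0" using I by (simp add: card_gt_0_iff)
  with pos_inverse_exists[OF adjG] adj_mult_self_sum_bounded_below[OF I E(1)]
  obtain H c where H: "pos H" "H * G = 1" "G * H = 1" and c: "c > 0" "bounded_below c H"
    unfolding G_def[symmetric] by metis
  define V where "V = psqrt H"
  \<comment> \<open>With \<open>V\<close> the inverse square root of \<open>G\<close>, this is the
    square root of \<open>G\<close>, the inverse of \<open>V\<close>.\<close>
  define W where "W = G * V"
  have V: "pos V" "V * V = H" using psqrt_pos[OF H(1)] psqrt_square[OF H(1)] by (simp_all add: V_def)
  have VG: "V * G = G * V" unfolding V_def by (rule psqrt_commute[OF H(1)]) (simp add: H)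
  have adjW: "adj W = W" by (simp add: W_def adjG pos_adj[OF V(1)] VG)
  have VW: "V * W = 1"
  proof -
    have "V * W = (V * V) * G" by (simp only: W_def VG[symmetric] mult.assoc)
    then show ?thesis by (simp add: V(2) H)
  qed
  have WV: "W * V = 1" by (simp add: W_def mult.assoc V(2) H)
  \<comment> \<open>In the inner product given by \<open>G\<close> the \<open>E i\<close> are thus
    self-adjoint modulo compact operators.\<close>
  have GE: "G * E i \<doteq> adj (E i) * E i" if i: "i \<in> I" for i
  proof -
    have "(\<Sum>j\<in>I. adj (E j) * (E j * E i)) \<doteq> (\<Sum>j\<in>I. if j = i then adj (E i) * E i else 0)"
    proof (rule ceq_sum)
      fix j assume j: "j \<in> I"
      have "adj (E j) * (E j * E i) \<doteq> adj (E j) * (if j = i then E j else 0)"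
        by (rule ceq_mult[OF ceq_refl EE[OF j i]])
      then show "adj (E j) * (E j * E i) \<doteq> (if j = i then adj (E i) * E i else 0)" by (cases "j = i") auto
    qed
    then show ?thesis using I(1) i by (simp add: G_def sum_distrib_right mult.assoc)
  qed
  \<comment> \<open>An exactly self-adjoint representative of \<open>W * E i * V\<close>, as
    \<open>lift_orthogonal_projections\<close> requires.\<close>
  define B where "B i = V * (adj (E i) * E i) * V" for i
  have adjB: "adj (B i) = B i" for i by (simp add: B_def pos_adj[OF V(1)] mult.assoc)
  have BE: "B i \<doteq> W * E i * V" if "i \<in> I" for i
  proof -
    have "B i \<doteq> V * (G * E i) * V" unfolding B_def by (intro ceq_mult ceq_refl ceq_sym[OF GE] that)
    also have "V * (G * E i) * V = W * E i * V" by (simp only: W_def VG[symmetric] mult.assoc)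
    finally show ?thesis .
  qed
  have BB: "B i * B j \<doteq> (if i = j then B i else 0)" if "i \<in> I" "j \<in> I" for i j
  proof -
    have "B i * B j \<doteq> (W * E i * V) * (W * E j * V)" by (intro ceq_mult BE that)
    also have "(W * E i * V) * (W * E j * V) = W * E i * (V * W) * E j * V" by (simp only: mult.assoc)
    also have "\<dots> = W * (E i * E j) * V" by (simp only: VW mult_1_right mult.assoc)
    also have "\<dots> \<doteq> W * (if i = j then E i else 0) * V" by (intro ceq_mult ceq_refl EE that)
    finally show ?thesis using ceq_sym[OF BE[OF that(1)]] by (cases "i = j") (auto intro: ceq_trans)
  qed
  \<comment> \<open>Indices with compact \<open>E i\<close> contribute nothing modulo compact
    operators. Dropping them leaves only noncompact projections, on which
    \<open>eigenvalue_le\<close> depends.\<close>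
  define J where "J = {i \<in> I. E i \<notin> cpt}"
  have J: "finite J" "J \<subseteq> I" using I(1) by (auto simp: J_def)
  have sumJ: "sum f J \<doteq> sum f I" if f: "\<And>i. i \<in> I \<Longrightarrow> E i \<in> cpt \<Longrightarrow> f i \<in> cpt" for f :: "'i \<Rightarrow> 'a cop"
  proof -
    have "sum f (I - J) \<in> cpt" by (rule cpt_sum) (use f in \<open>auto simp: J_def\<close>)
    then show ?thesis
      using cpt_uminus by (fastforce simp: ceq_def sum_diff[OF I(1) J(2)])
  qed
  have "\<exists>P. (\<forall>i\<in>J. adj (P i) = P i \<and> P i \<doteq> B i) \<and> (\<forall>i\<in>J. \<forall>j\<in>J. P i * P j = (if i = j then P i else 0))"
  proof (rule lift_orthogonal_projections[OF J(1)])
    show "adj (B i) = B i" for i by (rule adjB)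
    show "B i * B i \<doteq> B i" if "i \<in> J" for i using BB[of i i] that J(2) by auto
    show "B i * B j \<doteq> 0" if "i \<in> J" "j \<in> J" "i \<noteq> j" for i j using BB[of i j] that J(2) by auto
  qed
  then obtain P where P': "\<forall>i\<in>J. adj (P i) = P i \<and> P i \<doteq> B i"
    "\<forall>i\<in>J. \<forall>j\<in>J. P i * P j = (if i = j then P i else 0)" by (elim exE conjE) (rule that)
  have P: "adj (P i) = P i" if "i \<in> J" for i using P'(1) that by simp
  have PP: "P i * P j = (if i = j then P i else 0)" if "i \<in> J" "j \<in> J" for i j
    using P'(2) that by simp
  have PE: "P i \<doteq> W * E i * V" if "i \<in> J" for i
    using P'(1) BE[of i] that J(2) ceq_trans by blast
  have EP: "E i \<doteq> V * R * W" if "R \<doteq> W * E i * V" for R i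
  proof -
    have "E i = (V * W) * E i * (V * W)" by (simp add: VW)
    also have "\<dots> = V * (W * E i * V) * W" by (simp only: mult.assoc)
    also have "\<dots> \<doteq> V * R * W" by (intro ceq_mult ceq_refl ceq_sym[OF that])
    finally show ?thesis .
  qed
  have "J \<noteq> {}"
  proof
    assume "J = {}"
    then have "sum E I \<in> cpt" by (intro cpt_sum) (auto simp: J_def)
    with one show False by (simp add: E)
  qed
  then obtain k where k: "k \<in> J" by blast
  \<comment> \<open>A compact projection orthogonal to every \<open>P i\<close>; merged into
    \<open>P k\<close> it makes the sum exactly 1.\<close>
  define Q where "Q = 1 - sum P J"
  have "sum P J \<doteq> (\<Sum>i\<in>J. W * E i * V)" by (intro ceq_sum PE)
  also have "\<dots> \<doteq> (\<Sum>i\<in>I. W * E i * V)" by (rule sumJ) (intro cpt_mult_left cpt_mult_right)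
  also have "\<dots> = W * sum E I * V" by (simp add: sum_distrib_left sum_distrib_right)
  also have "\<dots> = 1" by (simp add: E WV)
  finally have Q0: "Q \<in> cpt" using ceq_sym by (auto simp: Q_def ceq_def)
  have adjQ: "adj Q = Q" by (simp add: Q_def P)
  have PQ: "P i * Q = 0" if "i \<in> J" for i
  proof -
    have "P i * sum P J = (\<Sum>j\<in>J. if j = i then P i else 0)"
      unfolding sum_distrib_left using PP that by (intro sum.cong) auto
    then show ?thesis using that J(1) by (simp add: Q_def right_diff_distrib)
  qed
  have QP: "Q * P i = 0" if "i \<in> J" for i
    using arg_cong[OF PQ[OF that], of adj] by (simp add: adjQ P that)
  have "Q * Q = Q - (\<Sum>i\<in>J. P i * Q)"
    by (subst (1) Q_def) (simp add: left_diff_distrib sum_distrib_right)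
  then have QQ: "Q * Q = Q" by (simp add: PQ)
  define P1 where "P1 i = (if i = k then P k + Q else P i)" for i
  have P1P: "P1 i \<doteq> P i" for i using Q0 by (simp add: P1_def ceq_def)
  have P1E: "P1 i \<doteq> W * E i * V" if "i \<in> J" for i by (rule ceq_trans[OF P1P PE[OF that]])
  have "adj (P1 i) = P1 i" if "i \<in> J" for i using P[OF that] P[OF k] adjQ by (simp add: P1_def)
  moreover have "P1 i \<notin> cpt" if "i \<in> J" for i
  proof
    assume "P1 i \<in> cpt"
    then have "V * P1 i * W \<in> cpt" by (intro cpt_mult_left cpt_mult_right)
    then have "E i \<doteq> 0" using EP[OF P1E[OF that]] by (metis ceq_trans ceq_zero_iff)
    with that show False by (simp add: J_def ceq_zero_iff)
  qed
  moreover have "P1 i * P1 j = (if i = j then P1 i else 0)" if "i \<in> J" "j \<in> J" for i j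
    using that by (auto simp: P1_def PP PQ QP QQ k distrib_left distrib_right)
  moreover have "sum P1 J = 1"
  proof -
    have "sum P1 J = (\<Sum>i\<in>J. P i + (if i = k then Q else 0))" by (rule sum.cong) (auto simp: P1_def)
    then show ?thesis using J(1) k by (simp add: sum.distrib Q_def)
  qed
  moreover have "T \<doteq> V * (\<Sum>i\<in>J. t i *\<^sub>R P1 i) * W"
  proof -
    have "T \<doteq> (\<Sum>i\<in>I. t i *\<^sub>R E i)" by (rule E)
    also have "\<dots> \<doteq> (\<Sum>i\<in>J. t i *\<^sub>R E i)" by (intro ceq_sym[OF sumJ] cpt_scaleR)
    also have "\<dots> \<doteq> (\<Sum>i\<in>J. t i *\<^sub>R (V * P1 i * W))" by (intro ceq_sum ceq_scaleR EP P1E)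
    also have "\<dots> = V * (\<Sum>i\<in>J. t i *\<^sub>R P1 i) * W" by (simp add: sum_distrib_left sum_distrib_right)
    finally show ?thesis .
  qed
  ultimately show ?thesis
    using V adjW VW WV c J(2)
    by (intro exI[of _ V] exI[of _ W] exI[of _ P1] exI[of _ J] exI[of _ c]) simp
qed

section \<open>Correcting the metric\<close>

text \<open>\<open>C\<close> stands for the essential norm of \<open>T\<close>, of which only
  approximability from above by norms of compact perturbations is recorded. \<open>Q = V * V\<close>
  is the metric to be corrected.\<close>

locale spectral_model =
  fixes T V W :: "'a::complex_hilbert_space cop" and P :: "'i \<Rightarrow> 'a cop" and J :: "'i set"
    and t :: "'i \<Rightarrow> real" and c C :: real
  assumes posV: "pos V" and adjW: "adj W = W" and VW: "V * W = 1" and WV: "W * V = 1"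
    and c: "c > 0" "bounded_below c (V * V)"
    and J: "finite J" and t: "inj_on t J"
    and P: "\<And>i. i \<in> J \<Longrightarrow> adj (P i) = P i" "\<And>i. i \<in> J \<Longrightarrow> P i \<notin> cpt"
    and PP: "\<And>i j. i \<in> J \<Longrightarrow> j \<in> J \<Longrightarrow> P i * P j = (if i = j then P i else 0)"
    and sumP: "sum P J = 1"
    and T: "T \<doteq> V * (\<Sum>i\<in>J. t i *\<^sub>R P i) * W"
    and C: "C \<ge> 0" "\<And>d. d > 0 \<Longrightarrow> \<exists>K\<in>cpt. norm (T + K) \<le> C + d"
begin

definition A :: "'a cop" where "A = (\<Sum>i\<in>J. t i *\<^sub>R P i)"

definition Q :: "'a cop" where "Q = V * V"

text \<open>
  For \<open>X = S\<^sup>2\<close> positive and invertible, positivity of the defect means \<open>\<parallel>S A S\<^sup>-\<^sup>1\<parallel> \<le> C\<close>.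
\<close>

definition defect :: "'a cop \<Rightarrow> 'a cop" where "defect X = C\<^sup>2 *\<^sub>R X - A * X * A"

text \<open>The absolute value of \<open>defect Q\<close>: exactly positive, and by
  \<open>Y_ceq\<close> a compact perturbation of \<open>defect Q\<close>.\<close>

definition Y :: "'a cop" where "Y = psqrt (defect Q * defect Q)"

lemma adjA: "adj A = A"
  by (simp add: A_def P)

lemma adjV: "adj V = V"
  by (rule pos_adj[OF posV])

lemma adjQ: "adj Q = Q"
  by (simp add: Q_def adjV)

lemma AP: "i \<in> J \<Longrightarrow> A * P i = t i *\<^sub>R P i"
proof -
  assume i: "i \<in> J"
  have "A * P i = (\<Sum>j\<in>J. if j = i then t i *\<^sub>R P i else 0)"
    unfolding A_def sum_distrib_right using PP i by (intro sum.cong) auto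
  then show ?thesis using J i by simp
qed

lemma PA: "i \<in> J \<Longrightarrow> P i * A = t i *\<^sub>R P i"
  using arg_cong[OF AP, of i adj] by (simp add: adjA P)

lemma adj_defect: "adj X = X \<Longrightarrow> adj (defect X) = defect X"
  by (simp add: defect_def adjA mult.assoc)

lemma P_defect_P:
  assumes "i \<in> J" "j \<in> J"
  shows "P i * defect X * P j = (C\<^sup>2 - t i * t j) *\<^sub>R (P i * X * P j)"
proof -
  have "P i * (A * X * A) * P j = (P i * A) * X * (A * P j)" by (simp only: mult.assoc)
  also have "\<dots> = (t i * t j) *\<^sub>R (P i * X * P j)" by (simp add: AP PA assms)
  finally show ?thesis
    by (simp add: defect_def left_diff_distrib right_diff_distrib scaleR_diff_left)
qed

section \<open>Essential positivity of the defect\<close>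

text \<open>If \<open>norm (T + K) \<le> C + \<delta>\<close>, then \<open>X = (T + K) * V\<close>
  is a compact perturbation of \<open>V * A\<close> and \<open>adj X * X\<close> is at most
  \<open>(C + \<delta>)\<^sup>2\<close> times \<open>Q\<close>. So
  \<open>C\<^sup>2 *\<^sub>R Q - adj X * X\<close> is almost positive and agrees with the defect
  modulo compact operators.\<close>

lemma defect_essentially_positive:
  assumes d: "d > 0"
  shows "\<exists>Z. adj Z = Z \<and> Z \<doteq> defect Q \<and> pos (Z + d *\<^sub>R 1)"
proof -
  define m where "m = norm Q + 1"
  have m: "m > 0" unfolding m_def by (rule norm_plus_one_pos)
  \<comment> \<open>Chosen so that the excess \<open>(2 * C + \<delta>) * \<delta>\<close> times
    \<open>norm Q\<close> is at most \<open>d\<close>; the cap 1 allows replacing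
    \<open>2 * C + \<delta>\<close> by \<open>2 * C + 1\<close>.\<close>
  define \<delta> where "\<delta> = min 1 (d / ((2 * C + 1) * m))"
  have \<delta>: "\<delta> > 0" "\<delta> \<le> 1" using d m C(1) by (simp_all add: \<delta>_def)
  define s where "s = (C + \<delta>)\<^sup>2 - C\<^sup>2"
  have s0: "s \<ge> 0" using \<delta>(1) C(1) by (simp add: s_def power2_eq_square algebra_simps)
  have "s = (2 * C + \<delta>) * \<delta>" by (simp add: s_def power2_eq_square algebra_simps)
  also have "\<dots> \<le> (2 * C + 1) * (d / ((2 * C + 1) * m))"
    by (rule mult_mono) (use \<delta> C(1) d m in \<open>auto simp: \<delta>_def\<close>)
  also have "\<dots> = d / m"
  proof -
    have k: "2 * C + 1 \<noteq> 0" using C(1) by linarith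
    show ?thesis by (simp only: times_divide_eq_right nonzero_mult_divide_mult_cancel_left[OF k])
  qed
  finally have "s * m \<le> d" using m by (simp add: field_simps)
  have "s * norm Q \<le> s * m" by (rule mult_left_mono[OF _ s0]) (simp add: m_def)
  with \<open>s * m \<le> d\<close> have sQ: "s * norm Q \<le> d" by linarith
  obtain K where K: "K \<in> cpt" "norm (T + K) \<le> C + \<delta>" using C(2)[OF \<delta>(1)] by blast
  define X where "X = (T + K) * V"
  have "T + K \<doteq> V * A * W + 0" unfolding A_def by (rule ceq_add[OF T]) (simp add: K ceq_zero_iff)
  then have "X \<doteq> (V * A * W + 0) * V" unfolding X_def by (intro ceq_mult ceq_refl)
  also have "(V * A * W + 0) * V = V * A" by (simp add: mult.assoc WV)
  finally have X: "X \<doteq> V * A" .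
  have XX: "adj X * X \<doteq> A * Q * A"
    using ceq_mult[OF ceq_adj[OF X] X] by (simp add: adjA adjV Q_def mult.assoc)
  define Z where "Z = C\<^sup>2 *\<^sub>R Q - adj X * X"
  have "adj Z = Z" by (simp add: Z_def adjQ)
  moreover have "Z \<doteq> defect Q" unfolding Z_def defect_def by (intro ceq_diff ceq_refl XX)
  moreover have "pos (Z + d *\<^sub>R 1)"
  proof (rule posI)
    fix x
    have Qx: "(Q \<cdot> x) \<bullet> x = (norm (V \<cdot> x))\<^sup>2" unfolding Q_def by (rule inner_square[OF adjV])
    have "norm (X \<cdot> x) \<le> norm (T + K) * norm (V \<cdot> x)" unfolding X_def app_mult by (rule norm_app)
    also have "\<dots> \<le> (C + \<delta>) * norm (V \<cdot> x)" by (rule mult_right_mono[OF K(2)]) simp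
    finally have "(norm (X \<cdot> x))\<^sup>2 \<le> (C + \<delta>)\<^sup>2 * ((Q \<cdot> x) \<bullet> x)"
      unfolding Qx power_mult_distrib[symmetric] by (rule power_mono) simp
    also have "\<dots> = C\<^sup>2 * ((Q \<cdot> x) \<bullet> x) + s * ((Q \<cdot> x) \<bullet> x)" by (simp add: s_def algebra_simps)
    also have "s * ((Q \<cdot> x) \<bullet> x) \<le> s * (norm Q * (norm x)\<^sup>2)"
      by (rule mult_left_mono[OF inner_app_le_norm s0])
    also have "\<dots> \<le> d * (norm x)\<^sup>2"
      using mult_right_mono[OF sQ, of "(norm x)\<^sup>2"] by (simp add: mult.assoc)
    finally have "(norm (X \<cdot> x))\<^sup>2 \<le> C\<^sup>2 * ((Q \<cdot> x) \<bullet> x) + d * (norm x)\<^sup>2" by simp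
    moreover have "((adj X * X) \<cdot> x) \<bullet> x = (norm (X \<cdot> x))\<^sup>2" by (rule inner_adj_mult_self)
    ultimately show "0 \<le> ((Z + d *\<^sub>R 1) \<cdot> x) \<bullet> x"
      by (simp add: Z_def inner_add inner_diff power2_norm_eq_inner)
  qed (simp add: \<open>adj Z = Z\<close>)
  ultimately show ?thesis by blast
qed

lemma Y_ceq: "Y \<doteq> defect Q"
  unfolding Y_def
  by (rule essentially_positive_ceq_abs[OF adj_defect[OF adjQ] defect_essentially_positive])

lemma posY: "pos Y"
  unfolding Y_def by (intro psqrt_pos pos_square adj_defect adjQ)

lemma PYP_ceq:
  assumes "i \<in> J" "j \<in> J"
  shows "P i * Y * P j \<doteq> (C\<^sup>2 - t i * t j) *\<^sub>R (P i * Q * P j)"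
  using ceq_mult[OF ceq_mult[OF ceq_refl Y_ceq] ceq_refl, of "P i" "P j"]
  by (simp only: P_defect_P[OF assms])

section \<open>Critical and subcritical eigenvalues\<close>

text \<open>Otherwise \<open>P i * Y * P i\<close> would be a negative multiple of
  \<open>P i * Q * P i\<close> modulo compact operators. The compact operator \<open>K\<close> is
  then a sum of two positive terms and dominates a positive multiple of \<open>P i\<close>, so
  \<open>P i\<close> would be compact.\<close>

lemma eigenvalue_le:
  assumes i: "i \<in> J"
  shows "(t i)\<^sup>2 \<le> C\<^sup>2"
proof (rule ccontr)
  define s where "s = (t i)\<^sup>2 - C\<^sup>2"
  assume "\<not> ?thesis"
  then have s: "s > 0" by (simp add: s_def)
  define K where "K = P i * Y * P i + s *\<^sub>R (P i * Q * P i)"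
  have "K \<doteq> (C\<^sup>2 - t i * t i) *\<^sub>R (P i * Q * P i) + s *\<^sub>R (P i * Q * P i)"
    unfolding K_def by (intro ceq_add PYP_ceq i ceq_refl)
  also have "\<dots> = 0" by (simp add: s_def power2_eq_square flip: scaleR_add_left)
  finally have K: "K \<in> cpt" by (simp add: ceq_zero_iff)
  have "P i \<in> cpt"
  proof (rule cpt_dominated[OF cpt_scaleR[OF K, of "1 / (s * c)"]])
    fix x
    let ?y = "P i \<cdot> x"
    have "s * (c * (norm ?y)\<^sup>2) \<le> s * ((Q \<cdot> ?y) \<bullet> ?y)"
      using c(2) s by (intro mult_left_mono) (simp_all add: bounded_below_def Q_def)
    also have "\<dots> \<le> (Y \<cdot> ?y) \<bullet> ?y + s * ((Q \<cdot> ?y) \<bullet> ?y)" using pos_inner[OF posY] by simp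
    also have "\<dots> = (K \<cdot> x) \<bullet> x"
      by (simp add: K_def inner_add selfadjoint_inner[OF P(1)[OF i], of _ x])
    also have "\<dots> \<le> norm (K \<cdot> x) * norm x" by (rule norm_cauchy_schwarz)
    finally show "(norm ?y)\<^sup>2 \<le> norm (((1 / (s * c)) *\<^sub>R K) \<cdot> x) * norm x"
      using s c(1) by (simp add: field_simps)
  qed
  with P(2)[OF i] show False by simp
qed

text \<open>Here the diagonal block \<open>P i * Y * P i\<close> is compact. Since \<open>Y\<close>
  is positive, \<open>psqrt Y * P i\<close> is compact, and with it every block
  \<open>P j * Y * P i\<close>, which is \<open>C\<^sup>2 - t j * t i\<close> times
  \<open>P j * Q * P i\<close> modulo compact operators.\<close>

lemma critical_offdiagonal:
  assumes i: "i \<in> J" and j: "j \<in> J" and ij: "i \<noteq> j" and crit: "(t i)\<^sup>2 = C\<^sup>2"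
  shows "P j * Q * P i \<in> cpt" "P i * Q * P j \<in> cpt"
proof -
  define X where "X = psqrt Y * P i"
  have "adj X * X = P i * (psqrt Y * psqrt Y) * P i"
    by (simp add: X_def P(1)[OF i] pos_adj[OF psqrt_pos[OF posY]] mult.assoc)
  also have "\<dots> = P i * Y * P i" by (simp only: psqrt_square[OF posY])
  also have "\<dots> \<doteq> (C\<^sup>2 - t i * t i) *\<^sub>R (P i * Q * P i)" by (rule PYP_ceq[OF i i])
  also have "\<dots> = 0" using crit by (simp add: power2_eq_square)
  finally have "X \<in> cpt" unfolding ceq_zero_iff by (rule cpt_adj_mult_self)
  then have "P j * psqrt Y * X \<in> cpt" by (rule cpt_mult_left)
  also have "P j * psqrt Y * X = P j * (psqrt Y * psqrt Y) * P i" by (simp only: X_def mult.assoc)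
  also have "\<dots> = P j * Y * P i" by (simp only: psqrt_square[OF posY])
  finally have "(C\<^sup>2 - t j * t i) *\<^sub>R (P j * Q * P i) \<in> cpt"
    using ceq_sym[OF PYP_ceq[OF j i]] by (metis ceq_trans ceq_zero_iff)
  then have "(1 / (C\<^sup>2 - t j * t i)) *\<^sub>R ((C\<^sup>2 - t j * t i) *\<^sub>R (P j * Q * P i)) \<in> cpt" by (rule cpt_scaleR)
  \<comment> \<open>If it vanished, then \<open>t i = 0\<close> since
    \<open>t i \<noteq> t j\<close>; so \<open>C = 0\<close>, and \<open>eigenvalue_le\<close> would
    force \<open>t j = 0\<close> as well.\<close>
  moreover have "C\<^sup>2 - t j * t i \<noteq> 0"
  proof
    assume "C\<^sup>2 - t j * t i = 0"
    then have "t i * (t i - t j) = 0" using crit by (simp add: power2_eq_square algebra_simps)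
    moreover have "t i \<noteq> t j" using t i j ij by (auto simp: inj_on_def)
    ultimately have "t i = 0" by simp
    with crit have "(t j)\<^sup>2 \<le> 0" using eigenvalue_le[OF j] by simp
    with \<open>t i = 0\<close> \<open>t i \<noteq> t j\<close> show False by simp
  qed
  ultimately show 1: "P j * Q * P i \<in> cpt" by simp
  show "P i * Q * P j \<in> cpt" using cpt_adj[OF 1] by (simp add: adjQ P i j mult.assoc)
qed

definition subcritical :: "'i \<Rightarrow> bool" where "subcritical i \<longleftrightarrow> (t i)\<^sup>2 < C\<^sup>2"

text \<open>
  The defect of \<open>q i j\<close> is \<open>P i * Y * P j\<close> when both indices are subcritical and \<open>0\<close> otherwise.
  Discarding the off-diagonal critical blocks is a compact change by \<open>critical_offdiagonal\<close>.
\<close>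

definition q :: "'i \<Rightarrow> 'i \<Rightarrow> 'a cop" where
  "q i j = (if subcritical i \<and> subcritical j then (1 / (C\<^sup>2 - t i * t j)) *\<^sub>R (P i * Y * P j)
    else if i = j then P i * Q * P i else 0)"

definition Q1 :: "'a cop" where "Q1 = (\<Sum>i\<in>J. \<Sum>j\<in>J. q i j)"

text \<open>\<open>t i * t j\<close> is at most the mean of the two squares, so the block
  coefficient may be divided by.\<close>

lemma subcritical_gap: "subcritical i \<Longrightarrow> subcritical j \<Longrightarrow> C\<^sup>2 - t i * t j > 0"
  using zero_le_power2[of "t i - t j"] by (simp add: subcritical_def power2_diff)

lemma q_ceq:
  assumes i: "i \<in> J" and j: "j \<in> J"
  shows "q i j \<doteq> P i * Q * P j"
proof (cases "subcritical i \<and> subcritical j")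
  case True
  have "q i j \<doteq> (1 / (C\<^sup>2 - t i * t j)) *\<^sub>R ((C\<^sup>2 - t i * t j) *\<^sub>R (P i * Q * P j))"
    using True by (simp only: q_def simp_thms if_True) (intro ceq_scaleR PYP_ceq i j)
  then show ?thesis using subcritical_gap[of i j] True by simp
next
  case False
  then have crit: "(t i)\<^sup>2 = C\<^sup>2 \<or> (t j)\<^sup>2 = C\<^sup>2"
    using eigenvalue_le[OF i] eigenvalue_le[OF j] by (auto simp: subcritical_def)
  show ?thesis
  proof (cases "i = j")
    case True
    then show ?thesis using False by (simp add: q_def)
  next
    case ij: False
    then have "P i * Q * P j \<in> cpt" using crit critical_offdiagonal[OF i j ij] critical_offdiagonal[OF j i] by auto
    moreover have "q i j = 0" using False ij by (auto simp: q_def)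
    ultimately show ?thesis by (simp add: ceq_sym ceq_zero_iff)
  qed
qed

lemma Q1_ceq: "Q1 \<doteq> Q"
proof -
  have "Q1 \<doteq> (\<Sum>i\<in>J. \<Sum>j\<in>J. P i * Q * P j)" unfolding Q1_def by (intro ceq_sum q_ceq)
  also have "\<dots> = sum P J * Q * sum P J"
    by (simp only: sum_distrib_right) (simp only: sum_distrib_left)
  also have "\<dots> = Q" by (simp add: sumP)
  finally show ?thesis .
qed

lemma adjQ1: "adj Q1 = Q1"
proof -
  have "adj (q i j) = q j i" if "i \<in> J" "j \<in> J" for i j
    using that by (auto simp: q_def P adjQ pos_adj[OF posY] mult.assoc mult.commute[of "t i"])
  then have "adj Q1 = (\<Sum>i\<in>J. \<Sum>j\<in>J. q j i)" by (simp add: Q1_def)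
  also have "\<dots> = Q1" unfolding Q1_def by (rule sum.swap)
  finally show ?thesis .
qed

lemma defect_block:
  assumes "i \<in> J" "j \<in> J" "X = P i * X * P j"
  shows "defect X = (C\<^sup>2 - t i * t j) *\<^sub>R X"
proof -
  have "A * X * A = A * (P i * X * P j) * A" using assms(3) by simp
  also have "\<dots> = (A * P i) * X * (P j * A)" by (simp only: mult.assoc)
  also have "\<dots> = (t i * t j) *\<^sub>R (P i * X * P j)" by (simp add: AP PA assms(1,2))
  finally show ?thesis using assms(3) by (simp add: defect_def scaleR_diff_left)
qed

lemma defect_sum: "defect (sum f I) = (\<Sum>i\<in>I. defect (f i))"
  by (simp add: defect_def scaleR_sum_right sum_distrib_left sum_distrib_right sum_subtractf)

lemma block_idem:
  assumes "i \<in> J" "j \<in> J"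
  shows "P i * (P i * X * P j) * P j = P i * X * P j"
proof -
  have "P i * (P i * X * P j) * P j = (P i * P i) * X * (P j * P j)" by (simp only: mult.assoc)
  then show ?thesis by (simp add: PP assms)
qed

text \<open>The block defects assemble to \<open>R * Y * R\<close>, where \<open>R\<close> is the
  sum of the subcritical projections, and \<open>Y\<close> is positive.\<close>

lemma pos_defect_Q1: "pos (defect Q1)"
proof -
  define R where "R = (\<Sum>i\<in>J. if subcritical i then P i else 0)"
  have "defect (q i j) = (if subcritical i then P i else 0) * Y * (if subcritical j then P j else 0)"
    if i: "i \<in> J" and j: "j \<in> J" for i j
  proof (cases "subcritical i \<and> subcritical j")
    case True
    have "defect (q i j) = (C\<^sup>2 - t i * t j) *\<^sub>R q i j"
      by (rule defect_block[OF i j]) (use True in \<open>simp add: q_def block_idem[OF i j]\<close>)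
    then show ?thesis using True subcritical_gap[of i j] by (simp add: q_def)
  next
    case False
    have "defect (q i j) = 0"
    proof (cases "i = j")
      case True
      have "defect (P i * Q * P i) = (C\<^sup>2 - t i * t i) *\<^sub>R (P i * Q * P i)"
        by (rule defect_block[OF i i]) (simp add: block_idem[OF i i])
      moreover have "C\<^sup>2 - t i * t i = 0"
        using False True eigenvalue_le[OF i] by (simp add: subcritical_def power2_eq_square)
      ultimately show ?thesis using False True by (simp add: q_def)
    next
      case ij: False
      then have "q i j = 0" using False by (auto simp: q_def)
      then show ?thesis by (simp add: defect_def)
    qed
    then show ?thesis using False by auto
  qed
  then have "defect Q1 = R * Y * R"
    by (simp only: R_def sum_distrib_right) (simp add: Q1_def defect_sum sum_distrib_left)
  moreover have "adj R = R" unfolding R_def by (simp add: P if_distrib cong: if_cong sum.cong)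
  ultimately show ?thesis using pos_conjugate_selfadjoint[OF posY] by simp
qed

section \<open>Restoring invertibility of the metric\<close>

definition K1 :: "'a cop" where "K1 = Q1 - Q"

text \<open>
  The pinching inequality gives \<open>K1\<^sup>2 \<le> card J * F\<close>, and \<open>c + K1 + K1\<^sup>2 / (2 c) \<ge> c / 2\<close>. Hence adding
  \<open>card J / (2 c) * F\<close> restores invertibility; \<open>F\<close> has positive defect because it is block diagonal.
\<close>

definition F :: "'a cop" where "F = (\<Sum>i\<in>J. P i * (K1 * K1) * P i)"

definition Q2 :: "'a cop" where "Q2 = Q1 + (card J / (2 * c)) *\<^sub>R F"

lemma adjK1: "adj K1 = K1"
  by (simp add: K1_def adjQ1 adjQ)

lemma Q2_ceq: "Q2 \<doteq> Q"
proof -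
  have "K1 \<in> cpt" using Q1_ceq by (simp add: K1_def ceq_def)
  then have "F \<in> cpt" unfolding F_def by (intro cpt_sum cpt_mult_right cpt_mult_left)
  then have "(card J / (2 * c)) *\<^sub>R F \<doteq> 0" unfolding ceq_zero_iff by (rule cpt_scaleR)
  from ceq_add[OF Q1_ceq this] show ?thesis by (simp add: Q2_def)
qed

lemma adjQ2: "adj Q2 = Q2"
  by (simp add: Q2_def F_def adjQ1 adjK1 P mult.assoc)

lemma pos_defect_Q2: "pos (defect Q2)"
proof -
  have "defect F = (\<Sum>i\<in>J. (C\<^sup>2 - t i * t i) *\<^sub>R (P i * (K1 * K1) * P i))"
    unfolding F_def defect_sum
    by (intro sum.cong refl defect_block) (simp_all add: block_idem)
  moreover have "pos ((C\<^sup>2 - t i * t i) *\<^sub>R (P i * (K1 * K1) * P i))" if "i \<in> J" for i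
    using eigenvalue_le[OF that] that
    by (intro pos_scaleR pos_conjugate_selfadjoint pos_square adjK1 P) (simp_all add: power2_eq_square)
  ultimately have "pos (defect F)" by (simp add: pos_sum)
  then have "pos ((card J / (2 * c)) *\<^sub>R defect F)" using c(1) by (intro pos_scaleR) simp_all
  then have "pos (defect Q1 + (card J / (2 * c)) *\<^sub>R defect F)" by (intro pos_add pos_defect_Q1)
  also have "defect Q1 + (card J / (2 * c)) *\<^sub>R defect F = defect Q2"
    by (simp add: defect_def Q2_def algebra_simps)
  finally show ?thesis .
qed

lemma Q2_bounded_below: "bounded_below (c / 2) Q2"
  unfolding bounded_below_def
proof
  fix x
  let ?a = "norm x" and ?b = "norm (K1 \<cdot> x)"
  have "?b = norm (K1 \<cdot> sum P J \<cdot> x)" by (simp add: sumP del: app_simps)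
  also have "\<dots> \<le> (\<Sum>i\<in>J. norm (K1 \<cdot> P i \<cdot> x))" by (simp add: norm_sum)
  finally have "?b\<^sup>2 \<le> (\<Sum>i\<in>J. norm (K1 \<cdot> P i \<cdot> x))\<^sup>2" by (rule power_mono) simp
  also have "\<dots> \<le> (\<Sum>i\<in>J. (norm (K1 \<cdot> P i \<cdot> x))\<^sup>2) * card J" by (rule sum_squared_le_sum_of_squares)
  also have "(\<Sum>i\<in>J. (norm (K1 \<cdot> P i \<cdot> x))\<^sup>2) = (F \<cdot> x) \<bullet> x"
    by (simp add: F_def inner_sum_left selfadjoint_inner[OF P(1)] selfadjoint_inner[OF adjK1] power2_norm_eq_inner)
  finally have F: "?b\<^sup>2 / (2 * c) \<le> card J / (2 * c) * ((F \<cdot> x) \<bullet> x)"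
    using c(1) by (simp add: divide_right_mono mult.commute)
  have "0 \<le> (c * ?a - ?b)\<^sup>2 / (2 * c)" using c(1) by simp
  also have "\<dots> = c / 2 * ?a\<^sup>2 - ?b * ?a + ?b\<^sup>2 / (2 * c)"
    using c(1) by (simp add: power2_diff power_mult_distrib field_simps power2_eq_square)
  finally have sq: "?b * ?a \<le> c / 2 * ?a\<^sup>2 + ?b\<^sup>2 / (2 * c)" by simp
  have K: "- (?b * ?a) \<le> (K1 \<cdot> x) \<bullet> x" using Cauchy_Schwarz_ineq2[of "K1 \<cdot> x" x] by linarith
  have Q: "c * ?a\<^sup>2 \<le> (Q \<cdot> x) \<bullet> x" using c(2) by (simp add: bounded_below_def Q_def)
  have "Q2 = Q + K1 + (card J / (2 * c)) *\<^sub>R F" by (simp add: Q2_def K1_def)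
  then have "(Q2 \<cdot> x) \<bullet> x = (Q \<cdot> x) \<bullet> x + (K1 \<cdot> x) \<bullet> x + card J / (2 * c) * ((F \<cdot> x) \<bullet> x)"
    by (simp add: inner_add)
  then show "c / 2 * ?a\<^sup>2 \<le> (Q2 \<cdot> x) \<bullet> x" using F sq K Q by linarith
qed

text \<open>\<open>T'\<close> is \<open>S * A * S'\<close> with \<open>S\<close> the square root of
  \<open>Q2\<close> and \<open>S'\<close> its inverse. Positivity of \<open>defect Q2\<close> is the
  norm bound, and conjugation keeps the eigenvalues \<open>t i\<close> exact.\<close>

lemma exact_model:
  "\<exists>T'. T' \<doteq> T \<and> norm T' \<le> C \<and> (\<forall>p. (\<forall>i\<in>J. poly p (t i) = 0) \<longrightarrow> peval p T' = 0)"
proof -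
  have "c / 2 > 0" using c(1) by simp
  from pos_inverse_exists[OF adjQ2 Q2_bounded_below this]
  obtain H where H: "pos H" "H * Q2 = 1" "Q2 * H = 1" by blast
  have posQ2: "pos Q2"
  proof (rule posI[OF adjQ2])
    fix x :: 'a
    have "0 \<le> c / 2 * (norm x)\<^sup>2" using c(1) by simp
    also have "\<dots> \<le> (Q2 \<cdot> x) \<bullet> x" using Q2_bounded_below by (simp add: bounded_below_def)
    finally show "0 \<le> (Q2 \<cdot> x) \<bullet> x" .
  qed
  define S where "S = psqrt Q2"
  have S: "pos S" "S * S = Q2" using psqrt_pos[OF posQ2] psqrt_square[OF posQ2] by (simp_all add: S_def)
  have SH: "S * H = H * S" unfolding S_def by (rule psqrt_commute[OF posQ2]) (simp add: H)
  define S' where "S' = H * S"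
  have S'S: "S' * S = 1" by (simp add: S'_def mult.assoc S(2) H)
  have SS': "S * S' = 1" by (simp add: S'_def SH[symmetric] S(2) H flip: mult.assoc)
  have "pos Q" unfolding Q_def by (rule pos_square[OF adjV])
  then have "S \<doteq> psqrt Q" unfolding S_def by (intro psqrt_ceq posQ2 Q2_ceq)
  also have "psqrt Q = V" by (rule psqrt_eqI[OF posV]) (simp add: Q_def)
  finally have SV: "S \<doteq> V" .
  \<comment> \<open>Inverses of operators congruent modulo compact ones are congruent too.\<close>
  have "S' * (V * W) \<doteq> S' * (S * W)" by (intro ceq_mult ceq_refl ceq_sym[OF SV])
  then have S'W: "S' \<doteq> W" by (simp add: VW S'S flip: mult.assoc)
  define T' where "T' = S * A * S'"
  have "T' \<doteq> V * A * W" unfolding T'_def by (intro ceq_mult SV S'W ceq_refl)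
  then have "T' \<doteq> T" using ceq_sym[OF T] unfolding A_def by (rule ceq_trans)
  moreover have "norm T' \<le> C"
  proof (rule norm_cop_bound[OF C(1)])
    fix x
    define y where "y = S' \<cdot> x"
    have x: "x = S \<cdot> y" using arg_cong[OF SS', of "\<lambda>X. X \<cdot> x"] by (simp add: y_def)
    have nS: "(norm (S \<cdot> z))\<^sup>2 = (Q2 \<cdot> z) \<bullet> z" for z
      using inner_square[OF pos_adj[OF S(1)], of z] by (simp only: S(2))
    have "(norm (T' \<cdot> x))\<^sup>2 = (Q2 \<cdot> A \<cdot> y) \<bullet> (A \<cdot> y)"
      unfolding nS[symmetric] by (simp add: T'_def y_def)
    also have "\<dots> = ((A * Q2 * A) \<cdot> y) \<bullet> y" by (simp add: selfadjoint_inner[OF adjA])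
    also have "\<dots> \<le> C\<^sup>2 * ((Q2 \<cdot> y) \<bullet> y)"
      using pos_inner[OF pos_defect_Q2, of y] by (simp add: defect_def inner_diff)
    also have "\<dots> = (C * norm x)\<^sup>2" unfolding x power_mult_distrib nS ..
    finally show "norm (T' \<cdot> x) \<le> C * norm x"
      by (rule power2_le_imp_le) (simp add: C)
  qed
  moreover have "peval p T' = 0" if p: "\<forall>i\<in>J. poly p (t i) = 0" for p
  proof (rule peval_eq_zero_of_spectral_sum)
    have "(\<Sum>i\<in>J. S * P i * S') = S * sum P J * S'" by (simp add: sum_distrib_left sum_distrib_right)
    also have "\<dots> = 1" by (simp add: sumP SS')
    finally show "(\<Sum>i\<in>J. S * P i * S') = 1" .
    fix i assume i: "i \<in> J"
    have "T' * (S * P i * S') = S * A * (S' * S) * P i * S'" by (simp only: T'_def mult.assoc)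
    also have "\<dots> = S * (A * P i) * S'" by (simp only: S'S mult_1_right mult.assoc)
    also have "\<dots> = t i *\<^sub>R (S * P i * S')" by (simp add: AP[OF i])
    finally show "T' * (S * P i * S') = t i *\<^sub>R (S * P i * S')" .
    show "poly p (t i) = 0" using p i by simp
  qed
  ultimately show ?thesis by blast
qed

end

section \<open>Transfer to the operators of the theorem\<close>

theorem theorem13:
  fixes T :: "'h::complex_hilbert_space \<Rightarrow>\<^sub>L 'h"
    and t :: "nat \<Rightarrow> real" and n :: nat and p :: "real poly"
  assumes p: "p = (\<Prod>i=1..n. [:- t i, 1:])"
    and distinct: "inj_on t {1..n}"
    and infinite_dim: "\<not> (\<exists>B :: 'h set. finite B \<and> complex_vector.span B = UNIV)"
    and T: "T \<in> bounded_ops"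
    and compact: "op_poly p T \<in> compact_ops"
  shows "\<exists>K \<in> compact_ops. op_poly p (T + K) = 0 \<and> norm (T + K) = essential_norm T"
proof -
  define A :: "'h cop" where "A = Abs_cop T"
  have A: "Rep_cop A = T" using T by (simp add: A_def Abs_cop_inverse)
  define C where "C = essential_norm T"
  let ?N = "norm ` {T + K | K. K \<in> compact_ops}"
  have zero: "0 \<in> compact_ops" using cpt_zero by (simp add: cpt_def zero_cop.rep_eq)
  then have ne: "?N \<noteq> {}" by blast
  have bdd: "bdd_below ?N" by (rule bdd_belowI[of _ 0]) auto
  have C_le: "C \<le> norm (T + K)" if "K \<in> compact_ops" for K
    unfolding C_def essential_norm_def by (rule cInf_lower[OF _ bdd]) (use that in blast)
  have C0: "C \<ge> 0" unfolding C_def essential_norm_def by (rule cInf_greatest[OF ne]) auto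
  have C_approx: "\<exists>K\<in>cpt. norm (A + K) \<le> C + d" if "d > 0" for d
  proof -
    have "Inf ?N < C + d" using that by (simp add: C_def essential_norm_def)
    then obtain K where K: "K \<in> compact_ops" "norm (T + K) < C + d"
      using cInf_lessD[OF ne] by blast
    then have "Rep_cop (Abs_cop K) = K" by (intro Abs_cop_inverse) (simp add: compact_ops_def)
    then have "Abs_cop K \<in> cpt" "norm (A + Abs_cop K) = norm (T + K)"
      using K(1) A by (simp_all add: cpt_def norm_cop.rep_eq plus_cop.rep_eq)
    then show ?thesis using K(2) by (intro bexI[of _ "Abs_cop K"]) auto
  qed
  have one: "(1 :: 'h cop) \<notin> cpt" by (rule one_notin_cpt[OF infinite_dim])
  have pA: "peval p A \<in> cpt" using compact by (simp add: cpt_def A flip: op_poly_Rep_cop)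
  \<comment> \<open>For \<open>n = 0\<close> the polynomial is 1 and the identity would be
    compact.\<close>
  have "{1..n} \<noteq> {}"
  proof
    assume "{1..n} = {}"
    then have "p = 1" unfolding p by simp
    with pA one show False by simp
  qed
  note I = finite_atLeastAtMost[of 1 n] this
  obtain E where E: "sum E {1..n} = 1" "A \<doteq> (\<Sum>i\<in>{1..n}. t i *\<^sub>R E i)"
    "\<forall>i\<in>{1..n}. \<forall>j\<in>{1..n}. E i * E j \<doteq> (if i = j then E i else 0)"
    using essential_spectral_idempotents[OF I distinct pA[unfolded p]] by (elim exE conjE) (rule that)
  obtain V W P J c where model: "pos V" "adj W = W" "V * W = 1" "W * V = 1" "c > 0" "bounded_below c (V * V)"
    "J \<subseteq> {1..n}" "\<forall>i\<in>J. adj (P i) = P i \<and> P i \<notin> cpt"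
    "\<forall>i\<in>J. \<forall>j\<in>J. P i * P j = (if i = j then P i else 0)" "sum P J = 1"
    "A \<doteq> V * (\<Sum>i\<in>J. t i *\<^sub>R P i) * W"
    using orthogonal_model_exists[OF I one E] by (elim exE conjE) (rule that)
  interpret spectral_model A V W P J t c C
    by unfold_locales
      (use model C0 C_approx finite_subset[OF model(7) I(1)] inj_on_subset[OF distinct model(7)] in simp_all)
  obtain S where S: "S \<doteq> A" "norm S \<le> C" "\<forall>p. (\<forall>i\<in>J. poly p (t i) = 0) \<longrightarrow> peval p S = 0"
    using exact_model by (elim exE conjE) (rule that)
  let ?K = "Rep_cop (S - A)"
  have TK: "T + ?K = Rep_cop S" by (simp add: minus_cop.rep_eq A)
  have K: "?K \<in> compact_ops" using S(1) by (simp add: ceq_def cpt_def)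
  have "poly p (t i) = 0" if "i \<in> J" for i
    using that model(7) by (auto simp: p poly_prod intro!: prod_zero bexI[of _ i])
  then have "peval p S = 0" using S(3) by blast
  then have "op_poly p (T + ?K) = 0" by (simp add: TK op_poly_Rep_cop zero_cop.rep_eq)
  \<comment> \<open>The model gives only \<open>\<le>\<close>; equality holds since no compact
    perturbation of \<open>T\<close> has norm below the essential norm.\<close>
  moreover have "norm (T + ?K) = essential_norm T"
    using C_le[OF K] S(2) by (simp add: TK C_def norm_cop.rep_eq)
  ultimately show ?thesis using K by blast
qed

end
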